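(* Let $(\mathcal W,\phi,\phi^+,\delta,F)$ be either $(W,\Phi,\Phi^+,\Delta,\mathcal C)$ (finite case) or $(W_a,\Phi_a,\Phi_a^+,\Delta_a,\mathcal A)$ (affine case). Let $I\subset\phi^+$ be consistent, and assume that for each $A\in\mathcal I$ the set $F_A=\{x\in V:\lambda(x)>0\ \forall\lambda\in A\}$ is the fundamental region for the reflection group $W_A$ generated by the reflections $s_\lambda$, $\lambda\in A$. If $f:V\to\mathbb{R}$ is integrable, then $$\int_F\sum_{w\in\mathcal W}\varepsilon(w)f(wy)\,dy=\sum_{A\in\mathcal I}\varepsilon_A\sum_{w\in W_A}\varepsilon(w)\int_{F_A}f(wy)\,dy.$$
   Context: Root systems. $V$ is a finite-dimensional real Euclidean space with inner product $\langle\cdot,\cdot\rangle$; $\Phi$ is an irreducible crystallographic root system in $V$ with Weyl group $W$, simple system $\Delta$, corresponding positive system $\Phi^+$, highest positive root $\widetilde\alpha$, and fundamental chamber $\mathcal C=\{x\in V:\langle\alpha,x\rangle>0\ \forall\alpha\in\Delta\}$. Put $\alpha^\vee=2\alpha/\langle\alpha,\alpha\rangle$, and let $L$ be the $\mathbb{Z}$-span of the coroots $\alpha^\vee$. The affine Weyl group $W_a$ is generated by the reflections in the hyperplanes $\{x:\langle x,\alpha\rangle=n\}$, $\alpha\in\Phi^+,n\in\mathbb{Z}$; each element is uniquely $w_a=\tau(l)w$ with $w\in W$ and $\tau(l)$ translation by $l\in L$. The sign is $\varepsilon(\tau(l)w)=\varepsilon(w)=\det w$. Affine roots. $\Phi_a=\Phi\times\mathbb{Z}$;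 for $\lambda=(\alpha,n)\in\Phi_a$, $\lambda(x)=\langle\alpha,x\rangle-n$ and $s_\lambda(x)=x-\lambda(x)\alpha^\vee$. $W_a$ acts on $\Phi_a$ by $\tau(l)w\,(\alpha,n)=(w\alpha,\,n+\langle w\alpha,l\rangle)$. $\Delta_a=\{(\alpha,0):\alpha\in\Delta\}\cup\{(-\widetilde\alpha,-1)\}$, $\Phi_a^+=\{(\alpha,n): (n=0\text{ and }\alpha\in\Phi^+)\text{ or }n\le -1\}$, and $\mathcal A=\{x\in V:\lambda(x)>0\ \forall\lambda\in\Delta_a\}$ is the fundamental alcove. In the finite case $\alpha\in\Phi$ is identified with $(\alpha,0)$. Two roots $(\alpha,m),(\beta,n)$ are orthogonal if $\langle\alpha,\beta\rangle=0$. Consistency. For $I\subset\phi^+$ let $\mathcal W^I=\{w\in\mathcal W:wI\subset\phi^+\}$ and $\mathcal I=\{wI:w\in\mathcal W^I\}$. $I$ is consistent if: (C1) there is a subset $J\subset\delta\cap I$ of pairwise orthogonal roots such that $J\subset A\in\mathcal I$ implies $A=I$; (C2) $\varepsilon(w)=1$ for every $w\in\mathcal W$ with $wI=I$; (C3) $\mathcal I$ is finite. By (C2), for $A\in\mathcal I$ the sign $\varepsilon_A:=\varepsilon(w)$, where $w\in\mathcal W^I$ is any element with $wI=A$, is well defined. "Fundamental region for $W_A$" means that the sets $wF_A$, $w\in W_A$, are pairwise disjoint and cover $V$ up to the union of the reflecting hyperplanes of $W_A$. "Integrable" is with respect to Lebesgue measure $dy$ on $V$. *)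

theory Defs
  imports
    "HOL-Analysis.Analysis"
    "HOL-Algebra.Bij"
    "HOL-Algebra.Generated_Groups"
begin

unbundle no m_inv_syntax

text \<open>An affine root (or, more generally, an affine functional) is a pair \<open>(\<alpha>, n)\<close> standing for
  \<open>x \<mapsto> \<langle>\<alpha>, x\<rangle> - n\<close>; affine roots proper have \<open>n \<in> \<int>\<close> (as a subset of the reals).
  A finite root \<open>\<alpha>\<close> is identified with \<open>(\<alpha>, 0)\<close>.\<close>

definition aff_val :: "'a::real_inner \<times> real \<Rightarrow> 'a \<Rightarrow> real" where
  "aff_val \<mu> x = fst \<mu> \<bullet> x - snd \<mu>"

definition coroot :: "'a::real_inner \<Rightarrow> 'a" where
  "coroot \<alpha> = (2 / (\<alpha> \<bullet> \<alpha>)) *\<^sub>R \<alpha>"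

definition aff_refl :: "'a::real_inner \<times> real \<Rightarrow> 'a \<Rightarrow> 'a" where
  "aff_refl \<mu> x = x - aff_val \<mu> x *\<^sub>R coroot (fst \<mu>)"

definition refl_group :: "('a::real_inner \<times> real) set \<Rightarrow> ('a \<Rightarrow> 'a) set" where
  "refl_group A = generate (BijGroup UNIV) (aff_refl ` A)"

definition pos_region :: "('a::real_inner \<times> real) set \<Rightarrow> 'a set" where
  "pos_region A = {x. \<forall>\<mu>\<in>A. 0 < aff_val \<mu> x}"


subsection \<open>Root systems\<close>

text \<open>The roots are not required to span the ambient space.\<close>

definition crystallographic_root_system :: "'a::euclidean_space set \<Rightarrow> bool" where
  "crystallographic_root_system \<Phi> \<longleftrightarrow>
     finite \<Phi> \<and> 0 \<notin> \<Phi> \<and>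
     (\<forall>\<alpha>\<in>\<Phi>. \<Phi> \<inter> span {\<alpha>} = {\<alpha>, - \<alpha>}) \<and>
     (\<forall>\<alpha>\<in>\<Phi>. aff_refl (\<alpha>, 0) ` \<Phi> = \<Phi>) \<and>
     (\<forall>\<alpha>\<in>\<Phi>. \<forall>\<beta>\<in>\<Phi>. \<beta> \<bullet> coroot \<alpha> \<in> \<int>)"

definition irreducible_roots :: "'a::real_inner set \<Rightarrow> bool" where
  "irreducible_roots \<Phi> \<longleftrightarrow> \<Phi> \<noteq> {} \<and>
     (\<forall>\<Phi>\<^sub>1 \<Phi>\<^sub>2. \<Phi>\<^sub>1 \<union> \<Phi>\<^sub>2 = \<Phi> \<and> (\<forall>\<alpha>\<in>\<Phi>\<^sub>1. \<forall>\<beta>\<in>\<Phi>\<^sub>2. \<alpha> \<bullet> \<beta> = 0) \<longrightarrow> \<Phi>\<^sub>1 = {} \<or> \<Phi>\<^sub>2 = {})"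

definition nonneg_combs :: "'a::real_vector set \<Rightarrow> 'a set" where
  "nonneg_combs \<Delta> = {(\<Sum>\<delta>\<in>\<Delta>. c \<delta> *\<^sub>R \<delta>) | c :: 'a \<Rightarrow> real. \<forall>\<delta>\<in>\<Delta>. 0 \<le> c \<delta>}"

definition simple_system :: "'a::euclidean_space set \<Rightarrow> 'a set \<Rightarrow> bool" where
  "simple_system \<Phi> \<Delta> \<longleftrightarrow> \<Delta> \<subseteq> \<Phi> \<and> independent \<Delta> \<and>
     (\<forall>\<alpha>\<in>\<Phi>. \<alpha> \<in> nonneg_combs \<Delta> \<or> - \<alpha> \<in> nonneg_combs \<Delta>)"

definition positive_roots :: "'a::euclidean_space set \<Rightarrow> 'a set \<Rightarrow> 'a set" where
  "positive_roots \<Phi> \<Delta> = \<Phi> \<inter> nonneg_combs \<Delta>"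

definition highest_root :: "'a::euclidean_space set \<Rightarrow> 'a set \<Rightarrow> 'a \<Rightarrow> bool" where
  "highest_root \<Phi> \<Delta> \<theta> \<longleftrightarrow> \<theta> \<in> positive_roots \<Phi> \<Delta> \<and>
     (\<forall>\<alpha>\<in>positive_roots \<Phi> \<Delta>. \<theta> - \<alpha> \<in> nonneg_combs \<Delta>)"

definition weyl_group :: "'a::euclidean_space set \<Rightarrow> ('a \<Rightarrow> 'a) set" where
  "weyl_group \<Phi> = refl_group (\<Phi> \<times> {0})"

definition fundamental_chamber :: "'a::euclidean_space set \<Rightarrow> 'a set" where
  "fundamental_chamber \<Delta> = {x. \<forall>\<alpha>\<in>\<Delta>. 0 < \<alpha> \<bullet> x}"

definition affine_weyl_group :: "'a::euclidean_space set \<Rightarrow> 'a set \<Rightarrow> ('a \<Rightarrow> 'a) set" where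
  "affine_weyl_group \<Phi> \<Delta> = refl_group (positive_roots \<Phi> \<Delta> \<times> \<int>)"

definition affine_roots :: "'a::euclidean_space set \<Rightarrow> ('a \<times> real) set" where
  "affine_roots \<Phi> = \<Phi> \<times> \<int>"

definition affine_positive_roots :: "'a::euclidean_space set \<Rightarrow> 'a set \<Rightarrow> ('a \<times> real) set" where
  "affine_positive_roots \<Phi> \<Delta> =
     {(\<alpha>, n) \<in> affine_roots \<Phi>. n = 0 \<and> \<alpha> \<in> positive_roots \<Phi> \<Delta> \<or> n \<le> - 1}"

definition affine_simple_roots :: "'a::euclidean_space set \<Rightarrow> 'a \<Rightarrow> ('a \<times> real) set" where
  "affine_simple_roots \<Delta> \<theta> = \<Delta> \<times> {0} \<union> {(- \<theta>, - 1)}"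

definition fundamental_alcove :: "'a::euclidean_space set \<Rightarrow> 'a \<Rightarrow> 'a set" where
  "fundamental_alcove \<Delta> \<theta> = pos_region (affine_simple_roots \<Delta> \<theta>)"


subsection \<open>Sign and action on affine roots\<close>

text \<open>In the decomposition \<open>w = \<tau>(l) u\<close> of an affine map \<open>w\<close> one has \<open>l = w 0\<close>, and
  \<open>u x = w x - w 0\<close>.\<close>

definition lin_part :: "('a::real_vector \<Rightarrow> 'a) \<Rightarrow> 'a \<Rightarrow> 'a" where
  "lin_part w x = w x - w 0"

text \<open>The library's determinant is confined to square matrices \<open>real ^ 'n ^ 'n\<close>; this is the same
  Leibniz formula for the matrix of a linear endomorphism in the standard orthonormal basis.\<close>

definition lin_det :: "('a::euclidean_space \<Rightarrow> 'a) \<Rightarrow> real" where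
  "lin_det u = (\<Sum>p | p permutes Basis. of_int (sign p) * (\<Prod>b\<in>Basis. u (p b) \<bullet> b))"

lemma lin_det_eq_det:
  fixes u :: "real ^ 'n \<Rightarrow> real ^ 'n"
  shows "lin_det u = det (matrix u)"
proof -
  define a where "a = (\<lambda>i. axis i (1::real) :: real^'n)"
  have inj: "inj a" by (simp add: a_def inj_on_def axis_eq_axis)
  have B: "(Basis :: (real^'n) set) = range a" by (auto simp: a_def Basis_vec_def)
  have bb: "bij_betw a UNIV Basis" using inj B by (simp add: bij_betw_def)
  have bb': "bij_betw (inv a) Basis UNIV" using bb by (rule bij_betw_inv_into)
  have m: "bij_betw (map_permutation UNIV a) {p. p permutes UNIV} {p. p permutes Basis}"
    by (rule bij_betw_byWitness[where f' = "map_permutation Basis (inv a)"])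
      (use bb bb' inj B in \<open>auto intro!: map_permutation_permutes map_permutation_compose_inv
         simp: f_inv_into_f\<close>)
  have s: "sign (map_permutation UNIV a p) = sign p" if "p permutes UNIV" for p
    using inj that by (simp add: sign_map_permutation)
  have e: "map_permutation UNIV a p (a i) = a (p i)" for p i
    using inj by (simp add: map_permutation_def inv_into_f_f)
  have pr: "(\<Prod>b\<in>Basis. u (map_permutation UNIV a p b) \<bullet> b) = (\<Prod>i\<in>UNIV. matrix u $ i $ p i)" for p
    unfolding B prod.reindex[OF inj] o_def e by (simp add: matrix_def a_def inner_axis)
  show ?thesis
    unfolding lin_det_def det_def sum.reindex_bij_betw[OF m, symmetric]
    by (intro sum.cong) (auto simp: s pr)
qed

definition eps :: "('a::euclidean_space \<Rightarrow> 'a) \<Rightarrow> real" where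
  "eps w = lin_det (lin_part w)"

definition root_act :: "('a::real_inner \<Rightarrow> 'a) \<Rightarrow> 'a \<times> real \<Rightarrow> 'a \<times> real" where
  "root_act w = (\<lambda>(\<alpha>, n). (lin_part w \<alpha>, n + lin_part w \<alpha> \<bullet> w 0))"

lemma root_act_translation_linear:
  assumes "linear u"
  shows "root_act (\<lambda>x. u x + l) (\<alpha>, n) = (u \<alpha>, n + u \<alpha> \<bullet> l)"
  using linear_0[OF assms] by (simp add: root_act_def lin_part_def)

lemma eps_translation_linear:
  assumes "linear u"
  shows "eps (\<lambda>x. u x + l) = lin_det u"
  using linear_0[OF assms] by (simp add: eps_def lin_part_def [abs_def])


subsection \<open>Consistent sets of roots\<close>

definition orth :: "'a::real_inner \<times> real \<Rightarrow> 'a \<times> real \<Rightarrow> bool" where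
  "orth \<mu> \<nu> \<longleftrightarrow> fst \<mu> \<bullet> fst \<nu> = 0"

definition pos_movers ::
    "('a::real_inner \<Rightarrow> 'a) set \<Rightarrow> ('a \<times> real) set \<Rightarrow> ('a \<times> real) set \<Rightarrow> ('a \<Rightarrow> 'a) set" where
  "pos_movers W P I = {w \<in> W. root_act w ` I \<subseteq> P}"

definition pos_orbit ::
    "('a::real_inner \<Rightarrow> 'a) set \<Rightarrow> ('a \<times> real) set \<Rightarrow> ('a \<times> real) set \<Rightarrow> ('a \<times> real) set set" where
  "pos_orbit W P I = {root_act w ` I | w. w \<in> pos_movers W P I}"

definition consistent ::
    "('a::euclidean_space \<Rightarrow> 'a) set \<Rightarrow> ('a \<times> real) set \<Rightarrow> ('a \<times> real) set \<Rightarrow> ('a \<times> real) set \<Rightarrow> bool"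
  where
  "consistent W P D I \<longleftrightarrow>
     (\<exists>J \<subseteq> D \<inter> I. pairwise orth J \<and> (\<forall>A \<in> pos_orbit W P I. J \<subseteq> A \<longrightarrow> A = I)) \<and>
     (\<forall>w \<in> W. root_act w ` I = I \<longrightarrow> eps w = 1) \<and>
     finite (pos_orbit W P I)"

text \<open>For consistent \<open>I\<close> this does not depend on the choice of \<open>w\<close>.\<close>

definition eps_set ::
    "('a::euclidean_space \<Rightarrow> 'a) set \<Rightarrow> ('a \<times> real) set \<Rightarrow> ('a \<times> real) set \<Rightarrow> ('a \<times> real) set \<Rightarrow> real"
  where
  "eps_set W P I A = eps (SOME w. w \<in> pos_movers W P I \<and> root_act w ` I = A)"


subsection \<open>Fundamental regions\<close>

definition reflecting_hyperplanes :: "('a::real_inner \<Rightarrow> 'a) set \<Rightarrow> 'a set set" where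
  "reflecting_hyperplanes G = {{x. aff_val \<mu> x = 0} | \<mu>. fst \<mu> \<noteq> 0 \<and> aff_refl \<mu> \<in> G}"

definition fundamental_region :: "'a::real_inner set \<Rightarrow> ('a \<Rightarrow> 'a) set \<Rightarrow> bool" where
  "fundamental_region R G \<longleftrightarrow>
     disjoint_family_on (\<lambda>w. w ` R) G \<and>
     UNIV - \<Union>(reflecting_hyperplanes G) \<subseteq> (\<Union>w\<in>G. w ` R)"

end

theory Submission
  imports Defs
begin

text \<open>
  Both sides are integrals of \<open>f\<close> against a sign function. Since the translates \<open>w F\<close>, \<open>w \<in> W\<close>, are
  disjoint and cover the space up to a null set, the left side is \<open>\<integral> f \<chi>\<close>, where \<open>\<chi> = \<epsilon>(w)\<close> on \<open>w F\<close>; likewise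
  the \<open>A\<close>-summand on the right is \<open>\<epsilon>\<^sub>A \<integral> f \<chi>\<^sub>A\<close>, where \<open>\<chi>\<^sub>A = \<epsilon>(w)\<close> on \<open>w F\<^sub>A\<close> for \<open>w \<in> W\<^sub>A\<close> and \<open>\<chi>\<^sub>A = 0\<close>
  elsewhere. It remains to see that \<open>h = \<Sum>\<^sub>A \<epsilon>\<^sub>A \<chi>\<^sub>A\<close> agrees with \<open>\<chi>\<close> almost everywhere.

  Let \<open>s\<close> be a simple reflection, with root \<open>\<kappa>\<close>. If \<open>\<kappa> \<in> A\<close> then \<open>\<chi>\<^sub>A \<circ> s = - \<chi>\<^sub>A\<close>. If \<open>\<kappa> \<notin> A\<close>
  then \<open>s A\<close> is again positive, \<open>\<epsilon>\<^bsub>sA\<^esub> = - \<epsilon>\<^sub>A\<close> and \<open>\<chi>\<^bsub>sA\<^esub> \<circ> s = \<chi>\<^sub>A\<close>. Hence \<open>h \<circ> s = - h\<close>, and so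
  \<open>h(w x) = \<epsilon>(w) h(x)\<close> for all \<open>w \<in> W\<close>. On \<open>F\<close> every \<open>\<chi>\<^sub>A\<close> equals 1, and \<open>\<Sum>\<^sub>A \<epsilon>\<^sub>A = 1\<close>: for \<open>\<kappa> \<in> J\<close> the
  involution \<open>A \<mapsto> s A\<close> cancels the sets that do not contain \<open>\<kappa>\<close>, and it preserves the condition
  of containing other elements of \<open>J\<close>, these being orthogonal to \<open>\<kappa>\<close>; so only \<open>A = I\<close> survives.
\<close>

subsection \<open>Rigid motions\<close>

abbreviation rigid :: "('a::real_inner \<Rightarrow> 'a) \<Rightarrow> bool" where
  "rigid w \<equiv> orthogonal_transformation (lin_part w)"

lemma affine_eq: "w x = lin_part w x + w 0"
  by (simp add: lin_part_def)

lemma rigid_linear: "rigid w \<Longrightarrow> linear (lin_part w)"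
  and rigid_inner: "rigid w \<Longrightarrow> lin_part w x \<bullet> lin_part w y = x \<bullet> y"
  by (auto simp: orthogonal_transformation_def)

lemma lin_part_comp:
  assumes "rigid v"
  shows "lin_part (v \<circ> w) = lin_part v \<circ> lin_part w"
proof
  fix x
  show "lin_part (v \<circ> w) x = (lin_part v \<circ> lin_part w) x"
    using linear_diff[OF rigid_linear[OF assms], of "w x" "w 0"]
    by (simp add: lin_part_def)
qed

lemma lin_part_id [simp]: "lin_part id = id"
  by (auto simp: lin_part_def)

lemma rigid_id [simp]: "rigid id"
  by (simp add: orthogonal_transformation_def linear_iff)

lemma rigid_comp: "rigid v \<Longrightarrow> rigid w \<Longrightarrow> rigid (v \<circ> w)"
  by (simp add: lin_part_comp orthogonal_transformation_compose)

lemma rigid_dist: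
  assumes "rigid w"
  shows "dist (w x) (w y) = dist x y"
proof -
  have "w x - w y = lin_part w (x - y)"
    using linear_diff[OF rigid_linear[OF assms], of x y] by (simp add: lin_part_def)
  then show ?thesis
    using orthogonal_transformation_norm[OF assms] by (simp add: dist_norm)
qed

lemma root_act_id [simp]: "root_act id \<mu> = \<mu>"
  by (simp add: root_act_def split: prod.split)

lemma root_act_comp:
  assumes "rigid v"
  shows "root_act (v \<circ> w) \<mu> = root_act v (root_act w \<mu>)"
  using affine_eq[of v "w 0"] rigid_inner[OF assms]
  by (cases \<mu>) (simp add: root_act_def lin_part_comp[OF assms] inner_add_right)

text \<open>The second coordinate of \<open>root_act\<close> is built for this: for
  \<open>w x = u x + l\<close> the term \<open>u \<alpha> \<bullet> l\<close> added to
  \<open>n\<close> cancels the translation inside \<open>u \<alpha> \<bullet> w x\<close>, and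
  \<open>u\<close> preserves inner products.\<close>

lemma aff_val_root_act:
  assumes "rigid w"
  shows "aff_val (root_act w \<mu>) (w x) = aff_val \<mu> x"
  using affine_eq[of w x] rigid_inner[OF assms]
  by (cases \<mu>) (simp add: root_act_def aff_val_def inner_add_right)

lemma coroot_inner: "\<alpha> \<bullet> coroot \<alpha> = (if \<alpha> = 0 then 0 else 2)"
  by (simp add: coroot_def)

text \<open>This is the conjugation rule for reflections, written without the inverse of
  \<open>w\<close>: invariance of \<open>aff_val\<close> gives the coefficient, and the linear part
  of \<open>w\<close> carries coroots to coroots.\<close>

lemma aff_refl_root_act:
  assumes "rigid w"
  shows "aff_refl (root_act w \<mu>) (w x) = w (aff_refl \<mu> x)"
proof -
  have "lin_part w (x - aff_val \<mu> x *\<^sub>R coroot (fst \<mu>))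
      = lin_part w x - aff_val \<mu> x *\<^sub>R coroot (lin_part w (fst \<mu>))"
    using rigid_linear[OF assms] rigid_inner[OF assms]
    by (simp add: linear_diff linear_scale coroot_def)
  moreover have "fst (root_act w \<mu>) = lin_part w (fst \<mu>)"
    by (simp add: root_act_def split: prod.split)
  ultimately show ?thesis
    unfolding aff_refl_def aff_val_root_act[OF assms]
    by (subst (1 2) affine_eq) simp
qed


subsection \<open>Affine reflections\<close>

lemma aff_refl_0: "aff_refl \<mu> 0 = snd \<mu> *\<^sub>R coroot (fst \<mu>)"
  by (simp add: aff_refl_def aff_val_def)

lemma lin_part_aff_refl: "lin_part (aff_refl \<mu>) x = x - (fst \<mu> \<bullet> x) *\<^sub>R coroot (fst \<mu>)"
  by (simp add: lin_part_def aff_refl_def aff_val_def algebra_simps)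

lemma lin_part_aff_refl_eq: "lin_part (aff_refl \<mu>) = aff_refl (fst \<mu>, 0)"
  by (simp add: fun_eq_iff lin_part_aff_refl aff_refl_def aff_val_def)

lemma rigid_aff_refl: "rigid (aff_refl \<mu>)"
proof -
  have "linear (lin_part (aff_refl \<mu>))"
    unfolding linear_iff lin_part_aff_refl by (simp add: algebra_simps inner_add_right)
  moreover have "lin_part (aff_refl \<mu>) x \<bullet> lin_part (aff_refl \<mu>) y = x \<bullet> y" for x y
    unfolding lin_part_aff_refl coroot_def
    by (cases "fst \<mu> = 0") (simp_all add: inner_diff_left inner_diff_right inner_commute field_simps)
  ultimately show ?thesis
    by (simp add: orthogonal_transformation_def)
qed

lemma aff_val_aff_refl: "aff_val \<mu> (aff_refl \<mu> x) = (if fst \<mu> = 0 then aff_val \<mu> x else - aff_val \<mu> x)"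
  by (simp add: aff_refl_def aff_val_def inner_diff_right coroot_inner)

lemma aff_refl_zero: "fst \<mu> = 0 \<Longrightarrow> aff_refl \<mu> = id"
  by (auto simp: aff_refl_def coroot_def)

lemma aff_refl_invol [simp]: "aff_refl \<mu> (aff_refl \<mu> x) = x"
proof (cases "fst \<mu> = 0")
  case False
  have "aff_refl \<mu> (aff_refl \<mu> x)
      = aff_refl \<mu> x - aff_val \<mu> (aff_refl \<mu> x) *\<^sub>R coroot (fst \<mu>)"
    by (simp add: aff_refl_def)
  then show ?thesis using False by (simp add: aff_val_aff_refl) (simp add: aff_refl_def)
qed (simp add: aff_refl_zero)

lemma aff_refl_comp_self [simp]: "aff_refl \<mu> \<circ> aff_refl \<mu> = id"
  by auto

text \<open>The translation part is \<open>snd \<mu>\<close> times the coroot, and the linear part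
  negates the coroot, whence the minus sign in the second coordinate. A zero root has coroot 0, so
  the formula covers it as well.\<close>

lemma root_act_aff_refl:
  "root_act (aff_refl \<mu>) \<nu> =
     (fst \<nu> - (fst \<mu> \<bullet> fst \<nu>) *\<^sub>R coroot (fst \<mu>), snd \<nu> - (fst \<nu> \<bullet> coroot (fst \<mu>)) * snd \<mu>)"
  by (cases \<nu>; cases "fst \<mu> = 0")
    (simp_all add: root_act_def lin_part_aff_refl aff_refl_0 coroot_def inner_diff_left inner_diff_right
      inner_commute field_simps)

lemma root_act_aff_refl_invol [simp]: "root_act (aff_refl \<mu>) (root_act (aff_refl \<mu>) \<nu>) = \<nu>"
  using root_act_comp[OF rigid_aff_refl, of \<mu> "aff_refl \<mu>" \<nu>] by simp

lemma root_act_aff_refl_self: "fst \<mu> \<noteq> 0 \<Longrightarrow> root_act (aff_refl \<mu>) \<mu> = - \<mu>"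
  by (cases \<mu>) (simp add: root_act_aff_refl coroot_inner coroot_def scaleR_2)

lemma root_act_aff_refl_orth: "orth \<mu> \<nu> \<Longrightarrow> root_act (aff_refl \<mu>) \<nu> = \<nu>"
  by (simp add: root_act_aff_refl orth_def coroot_def inner_commute)

lemma root_act_uminus: "rigid w \<Longrightarrow> root_act w (- \<mu>) = - root_act w \<mu>"
  by (cases \<mu>) (simp add: root_act_def linear_neg rigid_linear)

lemma aff_val_uminus [simp]: "aff_val (- \<mu>) x = - aff_val \<mu> x"
  by (simp add: aff_val_def)

lemma aff_refl_uminus [simp]: "aff_refl (- \<mu>) = aff_refl \<mu>"
  by (simp add: fun_eq_iff aff_refl_def coroot_def)

subsection \<open>Reflection groups as words in reflections\<close>

text \<open>Expressions are lists rather than group elements so that induction on their length is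
  available for the exchange argument.\<close>

definition word :: "('a::real_inner \<times> real) list \<Rightarrow> 'a \<Rightarrow> 'a" where
  "word ms = foldr (\<lambda>\<mu> g. aff_refl \<mu> \<circ> g) ms id"

lemma word_Nil [simp]: "word [] = id"
  and word_Cons [simp]: "word (\<mu> # ms) = aff_refl \<mu> \<circ> word ms"
  by (simp_all add: word_def)

lemma word_append: "word (ms @ ns) = word ms \<circ> word ns"
  by (induction ms) (auto simp: fun_eq_iff)

lemma word_rev: "word (rev ms) \<circ> word ms = id" "word ms \<circ> word (rev ms) = id"
  by (induction ms) (auto simp: fun_eq_iff word_append)

lemma rigid_word: "rigid (word ms)"
  by (induction ms) (simp_all only: word_Nil word_Cons rigid_id rigid_comp rigid_aff_refl)

lemma bij_word: "bij (word ms)"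
  using word_rev o_bij by blast

lemma bij_aff_refl: "bij (aff_refl \<mu>)"
  by (rule o_bij[of "aff_refl \<mu>"]) simp_all

lemma mult_BijGroup_UNIV:
  "bij f \<Longrightarrow> bij g \<Longrightarrow> f \<otimes>\<^bsub>BijGroup UNIV\<^esub> g = f \<circ> g"
  by (auto simp: BijGroup_def Bij_def compose_def fun_eq_iff)

text \<open>Reflections are involutions, so inverses of generators are again generators and plain
  products already exhaust the generated group.\<close>

lemma refl_group_eq_words: "refl_group A = word ` lists A"
proof
  interpret group "BijGroup (UNIV :: 'a set)" by (rule group_BijGroup)
  have one: "\<one>\<^bsub>BijGroup UNIV\<^esub> = (id :: 'a \<Rightarrow> 'a)"
    by (auto simp: BijGroup_def)
  have car: "f \<in> carrier (BijGroup UNIV) \<longleftrightarrow> bij f" for f :: "'a \<Rightarrow> 'a"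
    by (simp add: BijGroup_def Bij_def)
  have inv: "m_inv (BijGroup UNIV) (aff_refl \<mu>) = aff_refl \<mu>" for \<mu> :: "'a \<times> real"
    by (rule inv_equality) (auto simp: mult_BijGroup_UNIV one car bij_aff_refl)
  show "refl_group A \<subseteq> word ` lists A"
  proof
    fix g assume "g \<in> refl_group A"
    then show "g \<in> word ` lists A"
      unfolding refl_group_def
    proof induction
      case one
      show ?case by (rule image_eqI[of _ _ "[]"]) (auto simp: \<open>\<one>\<^bsub>BijGroup UNIV\<^esub> = id\<close>)
    next
      case (incl h)
      then obtain \<mu> where "\<mu> \<in> A" "h = aff_refl \<mu>" by auto
      then show ?case by (intro image_eqI[of _ _ "[\<mu>]"]) auto
    next
      case (inv h)
      then obtain \<mu> where "\<mu> \<in> A" "h = aff_refl \<mu>" by auto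
      then show ?case
        by (intro image_eqI[of _ _ "[\<mu>]"])
          (auto simp: \<open>\<And>\<mu>. m_inv (BijGroup UNIV) (aff_refl \<mu>) = aff_refl \<mu>\<close>)
    next
      case (eng h1 h2)
      then obtain ms ns where "ms \<in> lists A" "ns \<in> lists A" "h1 = word ms" "h2 = word ns"
        by auto
      then show ?case
        by (intro image_eqI[of _ _ "ms @ ns"]) (auto simp: mult_BijGroup_UNIV bij_word word_append)
    qed
  qed
  show "word ` lists A \<subseteq> refl_group A"
  proof (rule image_subsetI)
    fix ms assume "ms \<in> lists A"
    then show "word ms \<in> refl_group A"
      unfolding refl_group_def
    proof induction
      case Nil
      show ?case using generate.one[of "BijGroup UNIV" "aff_refl ` A"] by (simp only: one word_Nil)
    next
      case (Cons \<mu> ms)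
      then have "aff_refl \<mu> \<otimes>\<^bsub>BijGroup UNIV\<^esub> word ms \<in> generate (BijGroup UNIV) (aff_refl ` A)"
        by (auto intro: generate.eng generate.incl)
      then show ?case by (simp only: mult_BijGroup_UNIV bij_aff_refl bij_word word_Cons)
    qed
  qed
qed

lemma refl_group_id: "id \<in> refl_group A"
  unfolding refl_group_eq_words by (rule image_eqI[of _ _ "[]"]) auto

lemma refl_group_aff_refl: "\<mu> \<in> A \<Longrightarrow> aff_refl \<mu> \<in> refl_group A"
  unfolding refl_group_eq_words by (rule image_eqI[of _ _ "[\<mu>]"]) auto

lemma refl_group_comp: "v \<in> refl_group A \<Longrightarrow> w \<in> refl_group A \<Longrightarrow> v \<circ> w \<in> refl_group A"
  unfolding refl_group_eq_words by (force simp: word_append[symmetric])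

lemma refl_group_inverse:
  assumes "w \<in> refl_group A"
  obtains v where "v \<in> refl_group A" "v \<circ> w = id" "w \<circ> v = id"
proof -
  from assms obtain ms where "ms \<in> lists A" "w = word ms"
    unfolding refl_group_eq_words by auto
  then show thesis
    by (intro that[of "word (rev ms)"]) (auto simp: refl_group_eq_words word_rev)
qed

lemma refl_group_rigid: "w \<in> refl_group A \<Longrightarrow> rigid w"
  unfolding refl_group_eq_words by (auto simp: rigid_word)

lemma refl_group_mono:
  assumes "\<And>\<mu>. \<mu> \<in> A \<Longrightarrow> aff_refl \<mu> \<in> refl_group B"
  shows "refl_group A \<subseteq> refl_group B"
proof -
  have "word ms \<in> refl_group B" if "ms \<in> lists A" for ms
    using that by induction (simp_all add: assms refl_group_comp refl_group_id del: comp_apply id_apply)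
  then show ?thesis by (auto simp: refl_group_eq_words[of A])
qed

lemma countable_refl_group: "countable A \<Longrightarrow> countable (refl_group A)"
  unfolding refl_group_eq_words by (intro countable_image countable_lists)

text \<open>Each letter of a word is replaced by its conjugate under \<open>s\<close>, whose inverse
  is \<open>v\<close>; the inner factors cancel.\<close>

lemma refl_group_root_act:
  assumes "rigid s" and "v \<circ> s = id" and "s \<circ> v = id"
  shows "refl_group (root_act s ` A) = (\<lambda>g. s \<circ> g \<circ> v) ` refl_group A"
proof -
  have *: "word (map (root_act s) ms) = s \<circ> word ms \<circ> v" for ms
  proof (induction ms)
    case (Cons \<mu> ms)
    have "word (map (root_act s) (\<mu> # ms)) x = (s \<circ> word (\<mu> # ms) \<circ> v) x" for x
      using Cons aff_refl_root_act[OF \<open>rigid s\<close>] by (simp add: fun_eq_iff)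
    then show ?case by blast
  qed (use assms in auto)
  show ?thesis
    unfolding refl_group_eq_words lists_image image_image * ..
qed

lemma pos_region_root_act:
  assumes "rigid s" and "v \<circ> s = id" and "s \<circ> v = id"
  shows "pos_region (root_act s ` A) = s ` pos_region A"
proof (intro equalityI subsetI)
  fix x assume x: "x \<in> pos_region (root_act s ` A)"
  have "s (v x) = x" using assms(3) by (metis comp_apply id_apply)
  then have "v x \<in> pos_region A"
    using x aff_val_root_act[OF assms(1), of _ "v x"] by (simp add: pos_region_def)
  with \<open>s (v x) = x\<close> show "x \<in> s ` pos_region A" by force
qed (auto simp: pos_region_def aff_val_root_act[OF assms(1)])

subsection \<open>The sign\<close>

text \<open>Multilinear expansion: each \<open>v c\<close> is expanded in the basis, so the product
  over the basis becomes a sum over all maps \<open>f\<close> of the basis to itself. Non-injective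
  \<open>f\<close> contribute nothing, and the others are permutations.\<close>

lemma lin_det_comp:
  fixes u v :: "'a::euclidean_space \<Rightarrow> 'a"
  assumes "linear u"
  shows "lin_det (u \<circ> v) = lin_det u * lin_det v"
proof -
  let ?B = "Basis :: 'a set"
  let ?S = "{p. p permutes ?B}"
  have fS: "finite ?S" by (simp add: finite_permutations)
  have exp: "u (v c) \<bullet> b = (\<Sum>d\<in>?B. (v c \<bullet> d) * (u d \<bullet> b))" for b c
  proof -
    have "u (v c) = (\<Sum>d\<in>?B. (v c \<bullet> d) *\<^sub>R u d)"
      using assms by (subst euclidean_representation[of "v c", symmetric])
        (simp only: linear_sum linear_scale)
    then show ?thesis by (simp add: inner_sum_left)
  qed
  \<comment> \<open>\<open>D f\<close> is the determinant of \<open>v\<close> with its coordinates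
    selected by \<open>f\<close>, repetitions allowed.\<close>
  define D where "D = (\<lambda>f. \<Sum>p\<in>?S. of_int (sign p) * (\<Prod>b\<in>?B. v (p b) \<bullet> f b))"
  have "lin_det (u \<circ> v) = (\<Sum>p\<in>?S. of_int (sign p) *
      (\<Sum>f\<in>PiE ?B (\<lambda>_. ?B). \<Prod>b\<in>?B. (v (p b) \<bullet> f b) * (u (f b) \<bullet> b)))"
    by (simp add: lin_det_def exp prod_sum_PiE)
  also have "\<dots> = (\<Sum>f\<in>PiE ?B (\<lambda>_. ?B). (\<Prod>b\<in>?B. u (f b) \<bullet> b) * D f)"
    unfolding D_def sum_distrib_left
    by (subst sum.swap) (simp add: prod.distrib mult_ac)
  also have "\<dots> = (\<Sum>f\<in>{f \<in> PiE ?B (\<lambda>_. ?B). inj_on f ?B}. (\<Prod>b\<in>?B. u (f b) \<bullet> b) * D f)"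
  proof (rule sum.mono_neutral_right)
    show "\<forall>f\<in>PiE ?B (\<lambda>_. ?B) - {f \<in> PiE ?B (\<lambda>_. ?B). inj_on f ?B}. (\<Prod>b\<in>?B. u (f b) \<bullet> b) * D f = 0"
    proof
      fix f assume "f \<in> PiE ?B (\<lambda>_. ?B) - {f \<in> PiE ?B (\<lambda>_. ?B). inj_on f ?B}"
      then obtain i j where ij: "i \<in> ?B" "j \<in> ?B" "i \<noteq> j" "f i = f j"
        by (auto simp: inj_on_def)
      let ?t = "Transposition.transpose i j"
      have t: "?t permutes ?B" using ij by (simp add: permutes_swap_id)
      \<comment> \<open>Two selected coordinates agree: composing with the transposition leaves
        \<open>f\<close> alone but flips every sign, so \<open>D f = - D f\<close>.\<close>
      have ft: "f (?t b) = f b" for b using ij(4) by (auto simp: Transposition.transpose_def)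
      have "D f = (\<Sum>p\<in>?S. of_int (sign (p \<circ> ?t)) * (\<Prod>b\<in>?B. v ((p \<circ> ?t) b) \<bullet> f b))"
        unfolding D_def
        by (rule sum.reindex_bij_witness[of _ "\<lambda>p. p \<circ> ?t" "\<lambda>p. p \<circ> ?t"])
          (auto simp: comp_assoc intro: permutes_compose[OF t])
      also have "\<dots> = (\<Sum>p\<in>?S. - (of_int (sign p) * (\<Prod>b\<in>?B. v (p b) \<bullet> f b)))"
      proof (rule sum.cong[OF refl])
        fix p assume p: "p \<in> ?S"
        have "(\<Prod>b\<in>?B. v (p b) \<bullet> f b) = (\<Prod>b\<in>?B. v (p (?t b)) \<bullet> f (?t b))"
          by (rule prod.permute[OF t, unfolded comp_def])
        moreover have "sign (p \<circ> ?t) = - sign p"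
          using p t ij by (subst sign_compose) (auto simp: sign_swap_id permutes_imp_permutation[OF finite_Basis])
        ultimately show "of_int (sign (p \<circ> ?t)) * (\<Prod>b\<in>?B. v ((p \<circ> ?t) b) \<bullet> f b)
            = - (of_int (sign p) * (\<Prod>b\<in>?B. v (p b) \<bullet> f b))"
          by (simp add: ft)
      qed
      also have "\<dots> = - D f" by (simp add: D_def sum_negf)
      finally show "(\<Prod>b\<in>?B. u (f b) \<bullet> b) * D f = 0" by simp
    qed
  qed (auto intro: finite_PiE)
  \<comment> \<open>Injective maps in \<open>PiE\<close> are \<open>undefined\<close> off the basis,
    whereas permutations are the identity there; the reindexing only changes these outside
    values.\<close>
  also have "\<dots> = (\<Sum>q\<in>?S. (\<Prod>b\<in>?B. u (q b) \<bullet> b) * D q)"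
  proof (rule sum.reindex_bij_witness[of _ "\<lambda>q. restrict q ?B" "\<lambda>f b. if b \<in> ?B then f b else b"])
    fix f assume f: "f \<in> {f \<in> PiE ?B (\<lambda>_. ?B). inj_on f ?B}"
    let ?q = "\<lambda>b. if b \<in> ?B then f b else b"
    show "restrict ?q ?B = f" using f by (auto simp: fun_eq_iff PiE_def extensional_def)
    have "bij_betw f ?B ?B"
      using f endo_inj_surj[of ?B f] by (auto simp: bij_betw_def)
    then show "?q \<in> ?S"
      by (auto intro!: bij_imp_permutes simp: bij_betw_cong[of ?B ?q f])
    show "(\<Prod>b\<in>?B. u (?q b) \<bullet> b) * D ?q = (\<Prod>b\<in>?B. u (f b) \<bullet> b) * D f"
      by (simp add: D_def)
  next
    fix q assume q: "q \<in> ?S"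
    show "(\<lambda>b. if b \<in> ?B then restrict q ?B b else b) = q"
      using q by (auto simp: fun_eq_iff permutes_not_in)
    show "restrict q ?B \<in> {f \<in> PiE ?B (\<lambda>_. ?B). inj_on f ?B}"
      using q by (auto simp: permutes_in_image permutes_inj_on inj_on_restrict_eq)
  qed
  also have "\<dots> = (\<Sum>q\<in>?S. of_int (sign q) * (\<Prod>b\<in>?B. u (q b) \<bullet> b) * lin_det v)"
  proof (rule sum.cong[OF refl])
    fix q assume q: "q \<in> ?S"
    \<comment> \<open>Substituting \<open>p \<circ> q\<close> for \<open>p\<close> turns
      \<open>D q\<close> into a rearranged Leibniz formula for \<open>v\<close>, up to the factor
      \<open>sign q\<close>.\<close>
    have "D q = (\<Sum>p\<in>?S. of_int (sign (p \<circ> q)) * (\<Prod>b\<in>?B. v ((p \<circ> q) b) \<bullet> q b))"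
      unfolding D_def
      by (rule sum.reindex_bij_witness[of _ "\<lambda>p. p \<circ> q" "\<lambda>p. p \<circ> inv q"])
        (use q in \<open>auto simp: comp_assoc permutes_inv_o permutes_inv intro: permutes_compose\<close>)
    also have "\<dots> = (\<Sum>p\<in>?S. of_int (sign q) * (of_int (sign p) * (\<Prod>b\<in>?B. v (p b) \<bullet> b)))"
    proof (rule sum.cong[OF refl])
      fix p assume p: "p \<in> ?S"
      have "(\<Prod>b\<in>?B. v (p b) \<bullet> b) = (\<Prod>b\<in>?B. v (p (q b)) \<bullet> q b)"
        using q by (intro prod.permute[unfolded comp_def]) auto
      moreover have "sign (p \<circ> q) = sign p * sign q"
        using p q by (intro sign_compose) (auto simp: permutes_imp_permutation[OF finite_Basis])
      ultimately show "of_int (sign (p \<circ> q)) * (\<Prod>b\<in>?B. v ((p \<circ> q) b) \<bullet> q b)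
          = of_int (sign q) * (of_int (sign p) * (\<Prod>b\<in>?B. v (p b) \<bullet> b))" by simp
    qed
    also have "\<dots> = of_int (sign q) * lin_det v"
      by (simp add: lin_det_def sum_distrib_left)
    finally show "(\<Prod>b\<in>?B. u (q b) \<bullet> b) * D q = of_int (sign q) * (\<Prod>b\<in>?B. u (q b) \<bullet> b) * lin_det v"
      by simp
  qed
  also have "\<dots> = lin_det u * lin_det v"
    by (simp add: lin_det_def sum_distrib_right)
  finally show ?thesis .
qed

text \<open>A permutation other than the identity moves some basis vector \<open>b\<close>, and its
  product then contains the factor \<open>u (p b) \<bullet> b = 0\<close>.\<close>

lemma lin_det_diagonal:
  fixes u :: "'a::euclidean_space \<Rightarrow> 'a"
  assumes "\<And>b. b \<in> Basis \<Longrightarrow> u b = c b *\<^sub>R b"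
  shows "lin_det u = (\<Prod>b\<in>Basis. c b)"
proof -
  have "lin_det u = (\<Sum>p\<in>{id}. of_int (sign p) * (\<Prod>b\<in>Basis. u (p b) \<bullet> b))"
    unfolding lin_det_def
  proof (rule sum.mono_neutral_right)
    show "\<forall>p\<in>{p. p permutes Basis} - {id}. of_int (sign p) * (\<Prod>b\<in>Basis. u (p b) \<bullet> b) = (0::real)"
    proof
      fix p :: "'a \<Rightarrow> 'a" assume p: "p \<in> {p. p permutes Basis} - {id}"
      then obtain b where b: "p b \<noteq> b" by (auto simp: fun_eq_iff)
      with p have "b \<in> Basis" by (auto simp: permutes_def)
      moreover from p this have "p b \<in> Basis" by (simp add: permutes_in_image)
      ultimately have "u (p b) \<bullet> b = 0"
        using b by (simp add: assms inner_Basis)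
      with \<open>b \<in> Basis\<close> show "of_int (sign p) * (\<Prod>b\<in>Basis. u (p b) \<bullet> b) = (0::real)"
        by (auto intro!: prod_zero bexI)
    qed
  qed (auto simp: finite_permutations permutes_id)
  also have "\<dots> = (\<Prod>b\<in>Basis. c b)" by (simp add: assms)
  finally show ?thesis .
qed

lemma lin_det_id [simp]: "lin_det id = 1"
  using lin_det_diagonal[of id "\<lambda>_. 1"] by simp

lemma linear_aff_refl_0: "linear (aff_refl (\<alpha>, 0))"
  using rigid_linear[OF rigid_aff_refl, of "(\<alpha>, 0)"] by (simp add: lin_part_aff_refl_eq)

text \<open>The reflection in \<open>e - b\<close> interchanges the unit vectors \<open>e\<close> and \<open>b\<close>, so every reflection
  is conjugate to one in a basis vector.\<close>

lemma lin_det_aff_refl: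
  fixes \<alpha> :: "'a::euclidean_space"
  assumes "\<alpha> \<noteq> 0"
  shows "lin_det (aff_refl (\<alpha>, 0)) = - 1"
proof -
  obtain b :: 'a where b: "b \<in> Basis" using nonempty_Basis by blast
  define e where "e = \<alpha> /\<^sub>R norm \<alpha>"
  have ee: "e \<bullet> e = 1" using assms by (simp add: e_def dot_square_norm power2_eq_square)
  have bb: "b \<bullet> b = 1" using b by (simp add: inner_Basis)
  let ?s = "aff_refl (\<alpha>, 0)" and ?t = "aff_refl (b, 0)" and ?r = "aff_refl (e - b, 0)"
  have "b - 2 *\<^sub>R b = - b" by (simp add: scaleR_2)
  have "lin_det ?t = (\<Prod>c\<in>Basis. if c = b then - 1 else (1::real))"
    by (rule lin_det_diagonal)
      (use b \<open>b - 2 *\<^sub>R b = - b\<close> in \<open>auto simp: aff_refl_def aff_val_def coroot_def inner_Basis\<close>)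
  also have "\<dots> = - 1" using b by (simp add: prod.delta)
  finally have t: "lin_det ?t = - 1" .
  \<comment> \<open>If \<open>e = b\<close>, then \<open>?r\<close> degenerates to the identity, so
    its determinant is not fixed; its square is 1 in every case because \<open>?r\<close> is an
    involution, and the square is all that conjugation produces.\<close>
  have rr: "lin_det ?r * lin_det ?r = 1"
    using lin_det_comp[OF linear_aff_refl_0, of "e - b" ?r] by simp
  have rb: "?r b = e"
  proof (cases "e = b")
    case True then show ?thesis by (simp add: aff_refl_def aff_val_def)
  next
    case False
    then have "(e - b) \<bullet> (e - b) \<noteq> 0" by simp
    moreover have "(e - b) \<bullet> (e - b) = 2 - 2 * (e \<bullet> b)" "(e - b) \<bullet> b = e \<bullet> b - 1"
      using ee bb by (simp_all add: inner_diff_left inner_diff_right inner_commute)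
    ultimately have "((e - b) \<bullet> b) * (2 / ((e - b) \<bullet> (e - b))) = - 1"
      by (simp only: times_divide_eq_right divide_eq_eq) simp
    then have "aff_val (e - b, 0) b *\<^sub>R coroot (e - b) = - (e - b)"
      unfolding coroot_def aff_val_def scaleR_scaleR fst_conv snd_conv diff_0_right by simp
    then show ?thesis by (simp add: aff_refl_def)
  qed
  have "?s = aff_refl (e, 0)"
    using assms by (simp add: fun_eq_iff aff_refl_def aff_val_def coroot_def e_def field_simps power2_eq_square dot_square_norm)
  also have "\<dots> = aff_refl (root_act ?r (b, 0))"
    using rb by (simp add: root_act_def lin_part_def aff_refl_0)
  also have "\<dots> = ?r \<circ> ?t \<circ> ?r"
    using aff_refl_root_act[OF rigid_aff_refl, of "(e - b, 0)" "(b, 0)" "?r _"] by (simp add: fun_eq_iff)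
  finally have "lin_det ?s = lin_det ?r * lin_det ?t * lin_det ?r"
    by (simp only: lin_det_comp linear_aff_refl_0 linear_compose)
  with t rr show ?thesis by simp
qed

section \<open>Multiplicativity and values of the sign\<close>

lemma eps_id [simp]: "eps id = 1"
  by (simp add: eps_def)

lemma eps_comp: "rigid v \<Longrightarrow> eps (v \<circ> w) = eps v * eps w"
  by (simp add: eps_def lin_part_comp lin_det_comp rigid_linear)

lemma eps_aff_refl: "fst \<mu> \<noteq> 0 \<Longrightarrow> eps (aff_refl \<mu>) = - 1"
  by (simp add: eps_def lin_part_aff_refl_eq lin_det_aff_refl)

text \<open>A generator has sign -1, or sign 1 when its root is zero and the reflection degenerates
  to the identity.\<close>

lemma eps_refl_group: "w \<in> refl_group A \<Longrightarrow> \<bar>eps w\<bar> = 1"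
proof -
  have "\<bar>eps (aff_refl \<mu>)\<bar> = 1" for \<mu> :: "'a \<times> real"
    by (cases "fst \<mu> = 0") (simp_all add: eps_aff_refl aff_refl_zero)
  then have "\<bar>eps (word ms)\<bar> = 1" for ms :: "('a \<times> real) list"
    by (induction ms) (simp_all add: eps_comp rigid_aff_refl abs_mult del: comp_apply)
  then show "w \<in> refl_group A \<Longrightarrow> \<bar>eps w\<bar> = 1"
    by (auto simp: refl_group_eq_words)
qed

subsection \<open>Rigid motions preserve Lebesgue measure\<close>

lemma rigid_surj: "surj w" if "rigid w" for w :: "'a::euclidean_space \<Rightarrow> 'a"
proof -
  have "surj (lin_part w)" by (rule orthogonal_transformation_surj[OF that])
  then have "\<exists>x. y = w x" for y
    using affine_eq[of w] by (metis diff_add_cancel surjD)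
  then show ?thesis by (auto simp: surj_def)
qed

lemma rigid_bij: "bij w" if "rigid w" for w :: "'a::euclidean_space \<Rightarrow> 'a"
  using rigid_dist[OF that] rigid_surj[OF that] by (metis bij_def dist_eq_0_iff injI)

lemma rigid_image_ball: "w ` ball c r = ball (w c) r" if "rigid w" for w :: "'a::euclidean_space \<Rightarrow> 'a"
  using rigid_dist[OF that] rigid_surj[OF that] by (force simp: image_def surj_def)

lemma rigid_negligible_image:
  fixes w :: "'a::euclidean_space \<Rightarrow> 'a"
  assumes "rigid w" and "negligible S"
  shows "negligible (w ` S)"
proof (rule negligible_differentiable_image_negligible[OF order_refl assms(2)])
  have "(\<lambda>x. lin_part w x + w 0) differentiable_on S"
    using rigid_linear[OF assms(1)]
    by (intro derivative_intros linear_imp_differentiable_on) 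
  then show "w differentiable_on S" by (simp add: affine_eq[symmetric])
qed

text \<open>By Vitali, an open set is up to a null set a disjoint union of balls, and a rigid motion maps
  balls to balls of the same radius.\<close>

lemma rigid_emeasure_image_open:
  fixes w :: "'a::euclidean_space \<Rightarrow> 'a"
  assumes w: "rigid w" and U: "open U"
  shows "emeasure lebesgue (w ` U) = emeasure lebesgue U"
proof -
  define K where "K = {(c, r). 0 < r \<and> ball c r \<subseteq> U}"
  obtain C where C: "countable C" "C \<subseteq> K"
      "pairwise (\<lambda>i j. disjnt (ball (fst i) (snd i)) (ball (fst j) (snd j))) C"
      "negligible (U - (\<Union>i\<in>C. ball (fst i) (snd i)))"
  proof (rule Vitali_covering_theorem_balls[of U K fst snd])
    fix x and d :: real assume "x \<in> U" "0 < d"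
    then obtain e where "e > 0" "ball x e \<subseteq> U" using U open_contains_ball by blast
    with \<open>0 < d\<close> show "\<exists>i. i \<in> K \<and> x \<in> ball (fst i) (snd i) \<and> snd i < d"
      by (intro exI[of _ "(x, min e (d/2))"]) (auto simp: K_def)
  qed blast
  define N where "N = U - (\<Union>i\<in>C. ball (fst i) (snd i))"
  have U_eq: "U = (\<Union>i\<in>C. ball (fst i) (snd i)) \<union> N"
    using C(2) by (fastforce simp: N_def K_def)
  have inj: "inj w" using rigid_bij[OF w] by (rule bij_is_inj)
  have wU_eq: "w ` U = (\<Union>i\<in>C. ball (w (fst i)) (snd i)) \<union> w ` N"
    by (subst U_eq) (simp add: image_Un image_UN rigid_image_ball[OF w])
  have disj: "disjoint_family_on (\<lambda>i. ball (fst i) (snd i)) C"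
    using C(3) by (auto simp: disjoint_family_on_def pairwise_def disjnt_def)
  have disj': "disjoint_family_on (\<lambda>i. ball (w (fst i)) (snd i)) C"
    using disj unfolding disjoint_family_on_def rigid_image_ball[OF w, symmetric]
    by (simp add: image_Int[OF inj, symmetric])
  have "emeasure lebesgue U = emeasure lebesgue (\<Union>i\<in>C. ball (fst i) (snd i))"
    using C(1,4) by (subst U_eq, subst emeasure_Un_null_set)
      (auto simp: N_def negligible_iff_null_sets)
  also have "\<dots> = (\<integral>\<^sup>+i. emeasure lebesgue (ball (fst i) (snd i)) \<partial>count_space C)"
    by (rule emeasure_UN_countable) (use C(1) disj in auto)
  also have "\<dots> = (\<integral>\<^sup>+i. emeasure lebesgue (ball (w (fst i)) (snd i)) \<partial>count_space C)"
    using C(2) by (intro nn_integral_cong) (auto simp: K_def emeasure_ball)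
  also have "\<dots> = emeasure lebesgue (\<Union>i\<in>C. ball (w (fst i)) (snd i))"
    by (rule emeasure_UN_countable[symmetric]) (use C(1) disj' in auto)
  also have "\<dots> = emeasure lebesgue (w ` U)"
    using C(1) rigid_negligible_image[OF w C(4)] unfolding wU_eq
    by (subst emeasure_Un_null_set) (auto simp: N_def negligible_iff_null_sets)
  finally show ?thesis ..
qed

lemma rigid_continuous_on:
  fixes w :: "'a::euclidean_space \<Rightarrow> 'a"
  assumes "rigid w"
  shows "continuous_on S w"
  using rigid_dist[OF assms] by (auto simp: continuous_on_iff)

text \<open>The measure \<open>lborel\<close> is determined by the volumes of boxes, and the
  preimage of an open box is an open set whose image is the box, so invariance on open sets
  applies.\<close>

lemma distr_lborel_rigid:
  fixes w :: "'a::euclidean_space \<Rightarrow> 'a"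
  assumes "rigid w"
  shows "distr lborel borel w = lborel"
proof (rule lborel_eqI[symmetric])
  have [measurable]: "w \<in> borel_measurable borel"
    using rigid_continuous_on[OF assms] by (rule borel_measurable_continuous_onI)
  fix l u :: 'a assume le: "\<And>b. b \<in> Basis \<Longrightarrow> l \<bullet> b \<le> u \<bullet> b"
  have o: "open (w -` box l u)"
    using open_vimage[OF open_box rigid_continuous_on[OF assms]] by blast
  have "emeasure (distr lborel borel w) (box l u) = emeasure lebesgue (w -` box l u)"
    using o by (simp add: emeasure_distr)
  also have "\<dots> = emeasure lebesgue (w ` (w -` box l u))"
    by (rule rigid_emeasure_image_open[OF assms o, symmetric])
  also have "w ` (w -` box l u) = box l u"
    using rigid_surj[OF assms] by (rule surj_image_vimage_eq)
  also have "emeasure lebesgue (box l u) = (\<Prod>b\<in>Basis. (u - l) \<bullet> b)"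
    using le by simp
  finally show "emeasure (distr lborel borel w) (box l u) = (\<Prod>b\<in>Basis. (u - l) \<bullet> b)" .
qed simp

text \<open>Passage from \<open>lborel\<close> to its completion: since the image measure of
  \<open>w\<close> is \<open>lborel\<close> again, preimages of null sets are null.\<close>

lemma
  fixes w :: "'a::euclidean_space \<Rightarrow> 'a"
  assumes "rigid w"
  shows rigid_measurable: "w \<in> lebesgue \<rightarrow>\<^sub>M lebesgue"
    and distr_lebesgue_rigid: "distr lebesgue lebesgue w = lebesgue"
proof -
  have w: "w \<in> borel_measurable borel"
    using rigid_continuous_on[OF assms] by (rule borel_measurable_continuous_onI)
  have wl: "w \<in> lebesgue \<rightarrow>\<^sub>M lborel"
    using w by (simp add: measurable_completion)
  have d: "distr lebesgue lborel w = lborel"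
    using distr_completion[of w lborel lborel] w distr_lborel_rigid[OF assms]
    by (simp cong: distr_cong)
  show "w \<in> lebesgue \<rightarrow>\<^sub>M lebesgue"
    by (rule completion.measurable_completion2[OF wl]) (simp add: d)
  show "distr lebesgue lebesgue w = lebesgue"
    using completion.completion_distr_eq[OF wl] by (simp add: d)
qed

lemma
  fixes w :: "'a::euclidean_space \<Rightarrow> 'a" and f :: "'a \<Rightarrow> real"
  assumes "rigid w" and "integrable lebesgue f"
  shows integrable_rigid: "integrable lebesgue (\<lambda>x. f (w x))"
    and integral_rigid: "(LINT x|lebesgue. f (w x)) = (LINT x|lebesgue. f x)"
proof -
  note w = rigid_measurable[OF assms(1)] and d = distr_lebesgue_rigid[OF assms(1)]
  have f: "f \<in> borel_measurable lebesgue" using assms(2) by simp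
  show "integrable lebesgue (\<lambda>x. f (w x))"
    using integrable_distr_eq[OF w f] assms(2) by (simp add: d)
  show "(LINT x|lebesgue. f (w x)) = (LINT x|lebesgue. f x)"
    using integral_distr[OF w f] by (simp add: d)
qed

subsection \<open>Integrating over the translates of a region\<close>

text \<open>For real families unconditional and absolute summability coincide. This lets infinite
  sums over the group be read as integrals over counting measure.\<close>

lemma integrable_count_space_iff_summable_on:
  fixes h :: "'i \<Rightarrow> real"
  shows "integrable (count_space G) h \<longleftrightarrow> h summable_on G"
  by (metis abs_summable_equivalent abs_summable_on_def summable_on_iff_abs_summable_on_real)

lemma integral_count_space_eq_infsum:
  fixes h :: "'i \<Rightarrow> real"
  shows "(LINT g|count_space G. h g) = infsum h G"
proof (cases "h summable_on G")
  case True
  then have "Infinite_Set_Sum.abs_summable_on h G"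
    by (simp add: abs_summable_on_def integrable_count_space_iff_summable_on)
  then show ?thesis by (simp add: infsetsum_infsum[symmetric] infsetsum_def)
next
  case False
  then show ?thesis
    by (simp add: infsum_not_exists not_integrable_integral_eq integrable_count_space_iff_summable_on)
qed

text \<open>Fubini for the product of counting measure on \<open>G\<close> with \<open>M\<close>.
  Countability of \<open>G\<close> yields sigma-finiteness and joint measurability, and summability
  of the integrals of absolute values yields integrability on the product.\<close>

lemma
  fixes u :: "'i \<Rightarrow> 'b \<Rightarrow> real"
  assumes "sigma_finite_measure M" and G: "countable G"
    and u: "\<And>g. g \<in> G \<Longrightarrow> integrable M (u g)"
    and s: "(\<lambda>g. LINT y|M. \<bar>u g y\<bar>) summable_on G"
  shows AE_summable_on: "AE y in M. (\<lambda>g. u g y) summable_on G"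
    and integrable_infsum: "integrable M (\<lambda>y. \<Sum>\<^sub>\<infinity>g\<in>G. u g y)"
    and summable_on_integral: "(\<lambda>g. LINT y|M. u g y) summable_on G"
    and integral_infsum: "(LINT y|M. (\<Sum>\<^sub>\<infinity>g\<in>G. u g y)) = (\<Sum>\<^sub>\<infinity>g\<in>G. LINT y|M. u g y)"
proof -
  interpret pair_sigma_finite "count_space G" M
    by (simp add: pair_sigma_finite_def sigma_finite_measure_count_space_countable assms)
  have i: "integrable (count_space G \<Otimes>\<^sub>M M) (case_prod u)"
  proof (rule Fubini_integrable)
    show "case_prod u \<in> borel_measurable (count_space G \<Otimes>\<^sub>M M)"
      using G u by (intro measurable_pair_measure_countable1) auto
    show "integrable (count_space G) (\<lambda>x. LINT y|M. norm (case (x, y) of (x, xa) \<Rightarrow> u x xa))"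
      using s by (simp add: integrable_count_space_iff_summable_on)
    show "AE x in count_space G. integrable M (\<lambda>y. case (x, y) of (x, xa) \<Rightarrow> u x xa)"
      using u by (simp add: AE_count_space)
  qed
  show "AE y in M. (\<lambda>g. u g y) summable_on G"
    using AE_integrable_snd[OF i] by (simp add: integrable_count_space_iff_summable_on)
  show "integrable M (\<lambda>y. \<Sum>\<^sub>\<infinity>g\<in>G. u g y)"
    using integrable_snd[OF i] by (simp add: integral_count_space_eq_infsum)
  show "(\<lambda>g. LINT y|M. u g y) summable_on G"
    using integrable_fst[OF i] by (simp add: integrable_count_space_iff_summable_on)
  show "(LINT y|M. (\<Sum>\<^sub>\<infinity>g\<in>G. u g y)) = (\<Sum>\<^sub>\<infinity>g\<in>G. LINT y|M. u g y)"
    using Fubini_integral[OF i] by (simp add: integral_count_space_eq_infsum)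
qed

lemma sigma_finite_lebesgue: "sigma_finite_measure (lebesgue :: 'a::euclidean_space measure)"
proof
  obtain A :: "nat \<Rightarrow> 'a set" where "range A \<subseteq> sets lborel" "(\<Union>i. A i) = space lborel"
      "\<And>i. emeasure lborel (A i) \<noteq> \<infinity>"
    using lborel.sigma_finite by blast
  then show "\<exists>A. countable A \<and> A \<subseteq> sets lebesgue \<and> \<Union> A = space (lebesgue :: 'a measure)
      \<and> (\<forall>a\<in>A. emeasure lebesgue a \<noteq> \<infinity>)"
    by (intro exI[of _ "range A"]) auto
qed

context
  fixes G :: "('a::euclidean_space \<Rightarrow> 'a) set" and R :: "'a set" and f :: "'a \<Rightarrow> real"
  assumes rigid: "\<And>g. g \<in> G \<Longrightarrow> rigid g"
    and sets: "R \<in> sets lebesgue" "\<And>g. g \<in> G \<Longrightarrow> g ` R \<in> sets lebesgue"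
    and f: "integrable lebesgue f"
begin

lemma indicator_rigid_image:
  assumes "g \<in> G"
  shows "indicator (g ` R) (g y) = indicator R y"
  using bij_is_inj[OF rigid_bij[OF rigid[OF assms]]] by (auto simp: indicator_def inj_def)

text \<open>The substitution \<open>x = g y\<close> is applied to \<open>f\<close> cut off to the
  translate of \<open>R\<close> under \<open>g\<close>; injectivity of \<open>g\<close> turns that
  cut-off into the indicator of \<open>R\<close>.\<close>

lemma set_integrable_translate: "g \<in> G \<Longrightarrow> set_integrable lebesgue R (\<lambda>y. f (g y))"
  unfolding set_integrable_def
  using integrable_rigid[OF rigid, of g "\<lambda>x. indicator (g ` R) x *\<^sub>R f x"]
    integrable_mult_indicator[OF sets(2) f, of g] by (simp add: indicator_rigid_image)

lemma set_integral_translate: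
  "g \<in> G \<Longrightarrow> (LINT y:R|lebesgue. f (g y)) = (LINT x:g ` R|lebesgue. f x)"
  unfolding set_lebesgue_integral_def
  using integral_rigid[OF rigid, of g "\<lambda>x. indicator (g ` R) x *\<^sub>R f x"]
    integrable_mult_indicator[OF sets(2) f, of g] by (simp add: indicator_rigid_image)

end

text \<open>The interchange of sum and integral is made twice, once with all terms pulled back to
  \<open>R\<close> and once with each term living on its own translate. Both families have the same
  integrals, which links the two sides; disjointness of the translates bounds both by the integral
  of the absolute value of \<open>f\<close>.\<close>

lemma
  fixes G :: "('a::euclidean_space \<Rightarrow> 'a) set" and R :: "'a set" and f :: "'a \<Rightarrow> real"
    and e :: "('a \<Rightarrow> 'a) \<Rightarrow> real"
  assumes G: "countable G" "\<And>g. g \<in> G \<Longrightarrow> rigid g"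
    and R: "R \<in> sets lebesgue" "\<And>g. g \<in> G \<Longrightarrow> g ` R \<in> sets lebesgue"
    and disj: "disjoint_family_on (\<lambda>g. g ` R) G"
    and e: "\<And>g. g \<in> G \<Longrightarrow> \<bar>e g\<bar> = 1"
    and f: "integrable lebesgue f"
  shows AE_summable_on_translates:
      "AE y in lebesgue. y \<in> R \<longrightarrow> (\<lambda>g. e g * f (g y)) summable_on G"
    and set_integrable_infsum_translates:
      "set_integrable lebesgue R (\<lambda>y. \<Sum>\<^sub>\<infinity>g\<in>G. e g * f (g y))"
    and summable_on_integral_translates:
      "(\<lambda>g. e g * (LINT y:R|lebesgue. f (g y))) summable_on G"
    and set_integral_infsum_translates:
      "(LINT y:R|lebesgue. (\<Sum>\<^sub>\<infinity>g\<in>G. e g * f (g y)))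
         = (\<Sum>\<^sub>\<infinity>g\<in>G. e g * (LINT y:R|lebesgue. f (g y)))"
    and integrable_mult_sign_translates:
      "integrable lebesgue (\<lambda>x. f x * (\<Sum>g\<in>{g \<in> G. x \<in> g ` R}. e g))"
    and infsum_integral_translates:
      "(\<Sum>\<^sub>\<infinity>g\<in>G. e g * (LINT y:R|lebesgue. f (g y)))
         = (LINT x|lebesgue. f x * (\<Sum>g\<in>{g \<in> G. x \<in> g ` R}. e g))"
proof -
  note tr = set_integrable_translate[OF G(2) R] set_integral_translate[OF G(2) R]
  \<comment> \<open>\<open>u\<close> is the family pulled back to \<open>R\<close>, \<open>v\<close>
    the same family spread over the translates.\<close>
  define u where "u = (\<lambda>g y. e g * (indicator R y * f (g y)))"
  define v where "v = (\<lambda>g x. e g * (indicator (g ` R) x * f x))"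
  have af: "integrable lebesgue (\<lambda>x. \<bar>f x\<bar>)" using f by simp
  have iu: "integrable lebesgue (u g)" if "g \<in> G" for g
    using tr(1)[OF _ _ f that] by (simp add: u_def set_integrable_def)
  have iv: "integrable lebesgue (v g)" if "g \<in> G" for g
    using integrable_mult_indicator[OF R(2) f] that by (simp add: v_def)
  have Iu: "(LINT y|lebesgue. u g y) = e g * (LINT y:R|lebesgue. f (g y))" if "g \<in> G" for g
    by (simp add: u_def set_lebesgue_integral_def)
  have Iv: "(LINT y|lebesgue. v g y) = e g * (LINT y:R|lebesgue. f (g y))" if "g \<in> G" for g
    using tr(2)[OF _ _ f that] by (simp add: v_def set_lebesgue_integral_def)
  have au: "(LINT y|lebesgue. \<bar>u g y\<bar>) = (LINT x:g ` R|lebesgue. \<bar>f x\<bar>)" if "g \<in> G" for g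
    using tr(2)[OF _ _ af that] e[OF that] by (simp add: u_def abs_mult set_lebesgue_integral_def)
  have av: "(LINT y|lebesgue. \<bar>v g y\<bar>) = (LINT x:g ` R|lebesgue. \<bar>f x\<bar>)" if "g \<in> G" for g
    using e[OF that] by (simp add: v_def abs_mult set_lebesgue_integral_def)
  have sum: "(\<lambda>g. LINT x:g ` R|lebesgue. \<bar>f x\<bar>) summable_on G"
  proof (rule nonneg_bdd_above_summable_on)
    \<comment> \<open>By disjointness at most one indicator is nonzero at any point, so a finite
      partial sum never exceeds the full integral.\<close>
    have "(\<Sum>g\<in>F. LINT x:g ` R|lebesgue. \<bar>f x\<bar>) \<le> (LINT x|lebesgue. \<bar>f x\<bar>)"
      if F: "finite F" "F \<subseteq> G" for F
    proof -
      have int: "integrable lebesgue (\<lambda>x. indicator (g ` R) x * \<bar>f x\<bar>)" if "g \<in> F" for g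
        using integrable_mult_indicator[OF R(2) af] that F by auto
      have "(\<Sum>g\<in>F. indicator (g ` R) x) \<le> (1::real)" for x
      proof (cases "\<exists>g\<in>F. x \<in> g ` R")
        case True
        then obtain g where g: "g \<in> F" "x \<in> g ` R" by blast
        have "x \<notin> h ` R" if "h \<in> F" "h \<noteq> g" for h
          using disjoint_family_onD[OF disj, of h g] that g F by blast
        then have "(\<Sum>h\<in>F. indicator (h ` R) x) = (\<Sum>h\<in>F. if h = g then 1 else (0::real))"
          using g by (intro sum.cong refl) simp
        then show ?thesis using F g by simp
      qed (auto simp: indicator_def)
      then have "(\<Sum>g\<in>F. indicator (g ` R) x * \<bar>f x\<bar>) \<le> \<bar>f x\<bar>" for x
        using mult_right_mono[of "\<Sum>g\<in>F. indicator (g ` R) x" 1 "\<bar>f x\<bar>"]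
        by (simp add: sum_distrib_right)
      then have "(LINT x|lebesgue. (\<Sum>g\<in>F. indicator (g ` R) x * \<bar>f x\<bar>)) \<le> (LINT x|lebesgue. \<bar>f x\<bar>)"
        by (intro integral_mono af Bochner_Integration.integrable_sum int)
      then show ?thesis
        by (simp add: set_lebesgue_integral_def Bochner_Integration.integral_sum[OF int])
    qed
    then show "bdd_above (sum (\<lambda>g. LINT x:g ` R|lebesgue. \<bar>f x\<bar>) ` {F. F \<subseteq> G \<and> finite F})"
      by (auto intro!: bdd_aboveI)
  qed (simp add: set_lebesgue_integral_def)
  have su: "(\<lambda>g. LINT y|lebesgue. \<bar>u g y\<bar>) summable_on G"
    using sum by (rule summable_on_cong[THEN iffD1, rotated]) (simp add: au)
  have sv: "(\<lambda>g. LINT y|lebesgue. \<bar>v g y\<bar>) summable_on G"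
    using sum by (rule summable_on_cong[THEN iffD1, rotated]) (simp add: av)
  note U = sigma_finite_lebesgue G(1) iu su and V = sigma_finite_lebesgue G(1) iv sv
  have u_eq: "(\<Sum>\<^sub>\<infinity>g\<in>G. u g y) = indicator R y *\<^sub>R (\<Sum>\<^sub>\<infinity>g\<in>G. e g * f (g y))" for y
    by (cases "y \<in> R") (simp_all add: u_def)
  have v_eq: "(\<Sum>\<^sub>\<infinity>g\<in>G. v g x) = f x * (\<Sum>g\<in>{g \<in> G. x \<in> g ` R}. e g)" for x
  proof -
    \<comment> \<open>The sum over a set defaults to 0 if the set is infinite; disjointness leaves
      at most one index, so it agrees with the infinite sum.\<close>
    have fin: "finite {g \<in> G. x \<in> g ` R}"
    proof (cases "\<exists>g\<in>G. x \<in> g ` R")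
      case True
      then obtain g where "g \<in> G" "x \<in> g ` R" by blast
      then have "{g \<in> G. x \<in> g ` R} \<subseteq> {g}" using disj by (auto simp: disjoint_family_on_def)
      then show ?thesis by (rule finite_subset) simp
    next
      case False
      then have "{g \<in> G. x \<in> g ` R} = {}" by blast
      then show ?thesis by (simp only: finite.emptyI)
    qed
    have "(\<Sum>\<^sub>\<infinity>g\<in>G. v g x) = (\<Sum>\<^sub>\<infinity>g\<in>{g \<in> G. x \<in> g ` R}. f x * e g)"
      by (rule infsum_cong_neutral) (auto simp: v_def indicator_def)
    then show ?thesis using fin by (simp add: sum_distrib_left)
  qed
  show "AE y in lebesgue. y \<in> R \<longrightarrow> (\<lambda>g. e g * f (g y)) summable_on G"
    using AE_summable_on[OF U] by (rule AE_mp) (auto simp: u_def)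
  show "set_integrable lebesgue R (\<lambda>y. \<Sum>\<^sub>\<infinity>g\<in>G. e g * f (g y))"
    using integrable_infsum[OF U] by (simp add: u_eq set_integrable_def)
  show "(\<lambda>g. e g * (LINT y:R|lebesgue. f (g y))) summable_on G"
    using summable_on_integral[OF U] by (simp add: Iu cong: summable_on_cong)
  have "(LINT y:R|lebesgue. (\<Sum>\<^sub>\<infinity>g\<in>G. e g * f (g y))) = (\<Sum>\<^sub>\<infinity>g\<in>G. LINT y|lebesgue. u g y)"
    using integral_infsum[OF U] by (simp add: u_eq set_lebesgue_integral_def)
  then show "(LINT y:R|lebesgue. (\<Sum>\<^sub>\<infinity>g\<in>G. e g * f (g y)))
         = (\<Sum>\<^sub>\<infinity>g\<in>G. e g * (LINT y:R|lebesgue. f (g y)))"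
    by (simp add: Iu cong: infsum_cong)
  show "integrable lebesgue (\<lambda>x. f x * (\<Sum>g\<in>{g \<in> G. x \<in> g ` R}. e g))"
    using integrable_infsum[OF V] by (simp add: v_eq)
  have "(LINT x|lebesgue. f x * (\<Sum>g\<in>{g \<in> G. x \<in> g ` R}. e g)) = (\<Sum>\<^sub>\<infinity>g\<in>G. LINT y|lebesgue. v g y)"
    using integral_infsum[OF V] by (simp add: v_eq)
  then show "(\<Sum>\<^sub>\<infinity>g\<in>G. e g * (LINT y:R|lebesgue. f (g y)))
         = (LINT x|lebesgue. f x * (\<Sum>g\<in>{g \<in> G. x \<in> g ` R}. e g))"
    by (simp add: Iv cong: infsum_cong)
qed

subsection \<open>Sums of signs over the translates of a region\<close>

lemma sets_pos_region: "countable A \<Longrightarrow> pos_region A \<in> sets lebesgue"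
proof -
  assume "countable A"
  have "open {x. 0 < aff_val \<mu> x}" for \<mu> :: "'a \<times> real"
    unfolding aff_val_def by (intro open_Collect_less continuous_intros)
  then have "(\<Inter>\<mu>\<in>A. {x. 0 < aff_val \<mu> x}) \<in> sets lebesgue"
    using \<open>countable A\<close> by (intro sets.countable_INT'') auto
  moreover have "pos_region A = (\<Inter>\<mu>\<in>A. {x. 0 < aff_val \<mu> x})"
    by (auto simp: pos_region_def)
  ultimately show "pos_region A \<in> sets lebesgue" by simp
qed

text \<open>When the translates are disjoint, the sum has at most one term: it is the sign of the element
  carrying the region to \<open>x\<close>, and 0 off all translates.\<close>

definition sign_sum :: "('a::euclidean_space \<times> real) set \<Rightarrow> ('a \<times> real) set \<Rightarrow> 'a \<Rightarrow> real" where
  "sign_sum A B x = (\<Sum>g\<in>{g \<in> refl_group A. x \<in> g ` pos_region B}. eps g)"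

lemma sign_sum_disjoint:
  assumes "disjoint_family_on (\<lambda>w. w ` pos_region B) (refl_group A)" "g \<in> refl_group A" "x \<in> g ` pos_region B"
  shows "sign_sum A B x = eps g"
proof -
  have "{g \<in> refl_group A. x \<in> g ` pos_region B} = {g}"
    using assms by (auto simp: disjoint_family_on_def)
  then show ?thesis by (simp add: sign_sum_def)
qed

lemma aff_refl_mem_image_iff: "aff_refl \<mu> x \<in> S \<longleftrightarrow> x \<in> aff_refl \<mu> ` S"
  by (metis aff_refl_invol imageE imageI)

lemma image_aff_refl_invol [simp]: "aff_refl \<mu> ` aff_refl \<mu> ` S = S"
  by (simp add: image_image)

text \<open>Left multiplication by the reflection permutes the group and matches the translates
  containing the reflected point with those containing \<open>x\<close>; every sign changes.\<close>

lemma sign_sum_reflect: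
  assumes "\<mu> \<in> A" "fst \<mu> \<noteq> 0"
  shows "sign_sum A B (aff_refl \<mu> x) = - sign_sum A B x"
proof -
  let ?s = "aff_refl \<mu>"
  have s: "?s \<circ> (?s \<circ> g) = g" for g :: "'a \<Rightarrow> 'a" by (simp add: fun_eq_iff)
  have "sign_sum A B (?s x) = (\<Sum>g\<in>{g \<in> refl_group A. x \<in> g ` pos_region B}. eps (?s \<circ> g))"
    unfolding sign_sum_def
    by (rule sum.reindex_bij_witness[of _ "\<lambda>g. ?s \<circ> g" "\<lambda>g. ?s \<circ> g"])
      (use assms in \<open>auto simp: s refl_group_comp refl_group_aff_refl image_comp[symmetric] aff_refl_mem_image_iff
        simp del: comp_apply image_comp\<close>)
  also have "\<dots> = - sign_sum A B x"
    using assms(2) by (simp add: eps_comp rigid_aff_refl eps_aff_refl sign_sum_def sum_negf del: comp_apply)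
  finally show ?thesis .
qed

text \<open>Reflecting the root set conjugates the group and moves the region by the reflection.
  Conjugation uses the reflection twice, so no sign changes.\<close>

lemma sign_sum_root_act:
  assumes "fst \<mu> \<noteq> 0"
  shows "sign_sum (root_act (aff_refl \<mu>) ` A) (root_act (aff_refl \<mu>) ` A) (aff_refl \<mu> x) = sign_sum A A x"
proof -
  let ?s = "aff_refl \<mu>"
  let ?c = "\<lambda>g. ?s \<circ> g \<circ> ?s"
  have cc: "?c (?c g) = g" for g :: "'a \<Rightarrow> 'a" by (simp add: fun_eq_iff)
  have G: "refl_group (root_act ?s ` A) = ?c ` refl_group A"
    and R: "pos_region (root_act ?s ` A) = ?s ` pos_region A"
    by (rule refl_group_root_act[OF rigid_aff_refl aff_refl_comp_self aff_refl_comp_self],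
        rule pos_region_root_act[OF rigid_aff_refl aff_refl_comp_self aff_refl_comp_self])
  have mem: "?s x \<in> ?c g ` ?s ` pos_region A \<longleftrightarrow> x \<in> g ` pos_region A" for g
    by (simp only: image_comp[symmetric] image_aff_refl_invol aff_refl_mem_image_iff)
  have e: "eps (?c g) = eps g" if "g \<in> refl_group A" for g
    using assms refl_group_rigid[OF that]
    by (simp add: eps_comp rigid_comp rigid_aff_refl eps_aff_refl del: comp_apply)
  have "{g \<in> ?c ` refl_group A. ?s x \<in> g ` ?s ` pos_region A} = ?c ` {g \<in> refl_group A. x \<in> g ` pos_region A}"
    using mem by blast
  moreover have "inj_on ?c {g \<in> refl_group A. x \<in> g ` pos_region A}"
    by (rule inj_on_inverseI[of _ ?c]) (rule cc)
  ultimately show ?thesis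
    unfolding sign_sum_def G R by (simp add: sum.reindex e comp_def[of eps])
qed

subsection \<open>Reflection groups acting on affine roots\<close>

text \<open>Common ground of the finite and the affine case, both of which are shown to be instances
  further below. In place of finiteness of the root set stands \<open>locally_finite\<close>: only
  finitely many positive roots are negative at a given point.\<close>

locale affine_root_datum =
  fixes \<phi> P \<delta> :: "('a::euclidean_space \<times> real) set"
  assumes countable: "countable \<phi>"
    and nonzero: "\<mu> \<in> \<phi> \<Longrightarrow> fst \<mu> \<noteq> 0"
    and closed: "\<mu> \<in> \<phi> \<Longrightarrow> \<nu> \<in> \<phi> \<Longrightarrow> root_act (aff_refl \<mu>) \<nu> \<in> \<phi>"
    and reduced: "\<mu> \<in> \<phi> \<Longrightarrow> \<nu> \<in> \<phi> \<Longrightarrow> fst \<nu> \<in> span {fst \<mu>} \<Longrightarrow> fst \<nu> = fst \<mu> \<or> fst \<nu> = - fst \<mu>"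
    and pos_subset: "P \<subseteq> \<phi>"
    and pos_or_neg: "\<mu> \<in> \<phi> \<Longrightarrow> \<mu> \<in> P \<or> - \<mu> \<in> P"
    and finite_simple: "finite \<delta>"
    and simple_subset: "\<delta> \<subseteq> P"
    and simple_permutes: "\<kappa> \<in> \<delta> \<Longrightarrow> \<mu> \<in> P \<Longrightarrow> \<mu> \<noteq> \<kappa> \<Longrightarrow> root_act (aff_refl \<kappa>) \<mu> \<in> P"
    and region_nonempty: "pos_region \<delta> \<noteq> {}"
    and region_subset: "pos_region \<delta> \<subseteq> pos_region P"
    and locally_finite: "finite {\<mu> \<in> P. aff_val \<mu> x < 0}"
begin

abbreviation "W \<equiv> refl_group \<phi>"
abbreviation "F \<equiv> pos_region \<delta>"

lemma simple_pos: "\<kappa> \<in> \<delta> \<Longrightarrow> \<kappa> \<in> P"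
  using simple_subset by blast

lemma simple_root: "\<kappa> \<in> \<delta> \<Longrightarrow> \<kappa> \<in> \<phi>"
  using simple_pos pos_subset by blast

lemma simple_nonzero: "\<kappa> \<in> \<delta> \<Longrightarrow> fst \<kappa> \<noteq> 0"
  using simple_root nonzero by blast

lemma pos_on_region: "\<mu> \<in> P \<Longrightarrow> x \<in> F \<Longrightarrow> 0 < aff_val \<mu> x"
  using region_subset by (auto simp: pos_region_def)

text \<open>One of \<open>\<mu>\<close> and \<open>- \<mu>\<close> is positive, and positive roots
  have positive values on \<open>F\<close>; hence a single point of \<open>F\<close> decides
  positivity.\<close>

lemma pos_iff: "x \<in> F \<Longrightarrow> \<mu> \<in> \<phi> \<Longrightarrow> \<mu> \<in> P \<longleftrightarrow> 0 < aff_val \<mu> x"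
  using pos_on_region[of \<mu> x] pos_on_region[of "- \<mu>" x] pos_or_neg[of \<mu>] by auto

lemma uminus_pos: "\<mu> \<in> P \<Longrightarrow> - \<mu> \<notin> P"
  using region_nonempty pos_on_region[of \<mu>] pos_on_region[of "- \<mu>"] by fastforce

lemma root_act_closed: "w \<in> W \<Longrightarrow> \<mu> \<in> \<phi> \<Longrightarrow> root_act w \<mu> \<in> \<phi>"
proof -
  have "root_act (word ms) \<mu> \<in> \<phi>" if "ms \<in> lists \<phi>" "\<mu> \<in> \<phi>" for ms
    using that by induction (auto simp: root_act_comp[OF rigid_aff_refl] closed simp del: comp_apply)
  then show "w \<in> W \<Longrightarrow> \<mu> \<in> \<phi> \<Longrightarrow> root_act w \<mu> \<in> \<phi>"
    by (auto simp: refl_group_eq_words)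
qed

section \<open>Generation by simple reflections and the tiling by translates of the region\<close>

lemma simple_subgroup: "refl_group \<delta> \<subseteq> W"
  using simple_root by (intro refl_group_mono refl_group_aff_refl)

text \<open>The number of positive roots that are negative at \<open>y\<close> drops whenever \<open>y\<close> is reflected
  in a simple root that is negative at \<open>y\<close>.\<close>

lemma move_to_closure:
  obtains g where "g \<in> refl_group \<delta>" "\<And>\<kappa>. \<kappa> \<in> \<delta> \<Longrightarrow> 0 \<le> aff_val \<kappa> (g y)"
proof -
  let ?N = "\<lambda>y. {\<mu> \<in> P. aff_val \<mu> y < 0}"
  have "\<exists>g\<in>refl_group \<delta>. \<forall>\<kappa>\<in>\<delta>. 0 \<le> aff_val \<kappa> (g y)"
  proof (induction "card (?N y)" arbitrary: y rule: less_induct)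
    case less
    show ?case
    proof (cases "\<forall>\<kappa>\<in>\<delta>. 0 \<le> aff_val \<kappa> y")
      case True
      then show ?thesis by (intro bexI[of _ id]) (auto simp: refl_group_id)
    next
      case False
      then obtain \<kappa> where \<kappa>: "\<kappa> \<in> \<delta>" "aff_val \<kappa> y < 0" by force
      let ?s = "aff_refl \<kappa>"
      \<comment> \<open>Reflection embeds the roots negative at \<open>?s y\<close> into those
        negative at \<open>y\<close> but misses \<open>\<kappa>\<close>, whose preimage
        \<open>- \<kappa>\<close> is not positive; so the count drops strictly.\<close>
      have "root_act ?s ` ?N (?s y) \<subseteq> ?N y - {\<kappa>}"
      proof (rule image_subsetI)
        fix \<mu> assume "\<mu> \<in> ?N (?s y)"
        then have \<mu>: "\<mu> \<in> P" "aff_val \<mu> (?s y) < 0" by blast+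
        have "aff_val (root_act ?s \<mu>) y < 0"
          using \<mu>(2) aff_val_root_act[OF rigid_aff_refl, of \<kappa> \<mu> "?s y"] by simp
        moreover have "\<mu> \<noteq> \<kappa>"
          using \<mu>(2) \<kappa> simple_nonzero[OF \<kappa>(1)] aff_val_aff_refl[of \<kappa> y] by auto
        then have "root_act ?s \<mu> \<in> P" using simple_permutes \<kappa> \<mu> by blast
        moreover have "root_act ?s \<mu> \<noteq> \<kappa>"
        proof
          assume "root_act ?s \<mu> = \<kappa>"
          then have "\<mu> = - \<kappa>"
            using root_act_aff_refl_invol[of \<kappa> \<mu>] root_act_aff_refl_self[OF simple_nonzero[OF \<kappa>(1)]] by simp
          then show False using \<mu>(1) uminus_pos simple_pos[OF \<kappa>(1)] by metis
        qed
        ultimately show "root_act ?s \<mu> \<in> ?N y - {\<kappa>}" by blast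
      qed
      moreover have "inj_on (root_act ?s) (?N (?s y))"
        by (rule inj_on_inverseI[of _ "root_act ?s"]) simp
      moreover have "\<kappa> \<in> ?N y" using \<kappa> simple_subset by auto
      ultimately have "card (?N (?s y)) < card (?N y)"
        using locally_finite[of y]
        by (metis (no_types, lifting) card_Diff1_less card_inj_on_le finite_Diff le_less_trans)
      from less[OF this] obtain g where g: "g \<in> refl_group \<delta>" "\<forall>\<kappa>\<in>\<delta>. 0 \<le> aff_val \<kappa> (g (?s y))" by blast
      then show ?thesis
        using \<kappa>(1) by (intro bexI[of _ "g \<circ> ?s"] refl_group_comp refl_group_aff_refl) auto
    qed
  qed
  with that show thesis by blast
qed

lemma exchange:
  assumes "ms \<in> lists \<delta>" "\<kappa> \<in> \<delta>" "root_act (word ms) \<kappa> \<notin> P"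
  shows "\<exists>ns\<in>lists \<delta>. length ms = Suc (length ns) \<and> word ms \<circ> aff_refl \<kappa> = word ns"
  using assms
proof (induction ms)
  case Nil
  then show ?case using simple_pos by (simp add: id_def[symmetric] del: id_apply)
next
  case (Cons \<iota> ms)
  show ?case
  proof (cases "root_act (word ms) \<kappa> \<in> P")
    case False
    with Cons.IH Cons.prems obtain ns
      where "ns \<in> lists \<delta>" "length ms = Suc (length ns)" "word ms \<circ> aff_refl \<kappa> = word ns"
      by (metis listsE)
    moreover have "\<iota> \<in> \<delta>" using Cons.hyps by simp
    ultimately show ?thesis
      by (intro bexI[of _ "\<iota> # ns"]) (simp_all add: comp_assoc del: comp_apply)
  next
    case True
    have "root_act (word ms) \<kappa> = \<iota>"
      using Cons.hyps Cons.prems simple_permutes[OF _ True, of \<iota>]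
      by (auto simp: root_act_comp[OF rigid_aff_refl] simp del: comp_apply)
    then have "aff_refl \<iota> (word ms x) = word ms (aff_refl \<kappa> x)" for x
      using aff_refl_root_act[OF rigid_word] by metis
    then have "word (\<iota> # ms) \<circ> aff_refl \<kappa> = word ms"
      by (auto simp: fun_eq_iff simp flip: \<open>\<And>x. aff_refl \<iota> (word ms x) = word ms (aff_refl \<kappa> x)\<close>)
    then show ?thesis
      using Cons.hyps by (intro bexI[of _ ms]) (simp_all del: comp_apply word_Cons)
  qed
qed

text \<open>If the word ends in \<open>\<kappa>\<close>, the remaining prefix must send
  \<open>\<kappa>\<close> to a negative root; the exchange then rewrites the word with two letters
  fewer.\<close>

lemma word_fixing_positive:
  assumes "ms \<in> lists \<delta>" "\<And>\<mu>. \<mu> \<in> P \<Longrightarrow> root_act (word ms) \<mu> \<in> P"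
  shows "word ms = id"
  using assms
proof (induction "length ms" arbitrary: ms rule: less_induct)
  case less
  show ?case
  proof (cases ms rule: rev_cases)
    case (snoc ns \<kappa>)
    with less.prems have \<kappa>: "\<kappa> \<in> \<delta>" and ns: "ns \<in> lists \<delta>" by auto
    have w: "word ms = word ns \<circ> aff_refl \<kappa>" by (simp add: snoc word_append)
    have "root_act (word ms) \<kappa> = - root_act (word ns) \<kappa>"
      using \<kappa> by (simp add: w root_act_comp root_act_uminus rigid_word root_act_aff_refl_self simple_nonzero
          del: comp_apply)
    moreover have "root_act (word ms) \<kappa> \<in> P" using less.prems(2) \<kappa> simple_pos by blast
    ultimately have "root_act (word ns) \<kappa> \<notin> P" using uminus_pos by metis
    from exchange[OF ns \<kappa> this] obtain ks
      where ks: "ks \<in> lists \<delta>" "length ns = Suc (length ks)" "word ms = word ks"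
      using w by metis
    then show ?thesis using less.hyps[of ks] less.prems(2) snoc by simp
  qed simp
qed

text \<open>Moving the following point into the closure of \<open>F\<close> puts it on a simple hyperplane, so that
  \<open>aff_refl \<mu>\<close> is conjugate to a simple reflection.\<close>

lemma generic_point_on_hyperplane:
  assumes \<mu>: "\<mu> \<in> \<phi>"
  obtains y where "aff_val \<mu> y = 0" "\<And>\<nu>. \<nu> \<in> \<phi> \<Longrightarrow> aff_val \<nu> y = 0 \<Longrightarrow> \<nu> = \<mu> \<or> \<nu> = - \<mu>"
proof -
  obtain \<alpha> n where \<mu>_eq: "\<mu> = (\<alpha>, n)" by fastforce
  have \<alpha>: "\<alpha> \<noteq> 0" using nonzero[OF \<mu>] \<mu>_eq by simp
  \<comment> \<open>\<open>p\<close> is the orthogonal projection onto the hyperplane of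
    \<open>\<mu>\<close>.\<close>
  define p where "p = (\<lambda>x. x - (aff_val \<mu> x / (\<alpha> \<bullet> \<alpha>)) *\<^sub>R \<alpha>)"
  have p0: "aff_val \<mu> (p x) = 0" for x
    using \<alpha> by (simp add: p_def \<mu>_eq aff_val_def inner_diff_right)
  have neg: "negligible {x. aff_val \<nu> (p x) = 0}" if \<nu>: "\<nu> \<in> \<phi> - {\<mu>, - \<mu>}" for \<nu>
  proof -
    obtain \<beta> m where \<nu>_eq: "\<nu> = (\<beta>, m)" by fastforce
    define c where "c = (\<beta> \<bullet> \<alpha>) / (\<alpha> \<bullet> \<alpha>)"
    have "{x. aff_val \<nu> (p x) = 0} = {x. (\<beta> - c *\<^sub>R \<alpha>) \<bullet> x = m - c * n}"
      using \<alpha> by (auto simp: p_def \<mu>_eq \<nu>_eq aff_val_def inner_diff_right inner_diff_left c_def field_simps)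
    \<comment> \<open>The equation in \<open>x\<close> is not trivially true: if
      \<open>\<beta>\<close> is a multiple of \<open>\<alpha>\<close>, then \<open>c\<close> is 1 or
      -1, and as \<open>\<nu>\<close> is neither \<open>\<mu>\<close> nor \<open>- \<mu>\<close> the
      constant terms differ.\<close>
    moreover have "\<beta> - c *\<^sub>R \<alpha> \<noteq> 0 \<or> m - c * n \<noteq> 0"
    proof (cases "\<beta> - c *\<^sub>R \<alpha> = 0")
      case True
      then have "\<beta> \<in> span {\<alpha>}" by (auto simp: span_singleton)
      then have "\<beta> = \<alpha> \<or> \<beta> = - \<alpha>" using reduced[OF \<mu>, of \<nu>] \<nu> by (simp add: \<mu>_eq \<nu>_eq)
      then show ?thesis using \<nu> \<alpha> by (auto simp: c_def \<mu>_eq \<nu>_eq)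
    qed simp
    ultimately show ?thesis by (simp add: negligible_hyperplane)
  qed
  have "negligible (\<Union>\<nu>\<in>\<phi> - {\<mu>, - \<mu>}. {x. aff_val \<nu> (p x) = 0})"
    using countable neg by (intro negligible_countable_Union) auto
  then have "(\<Union>\<nu>\<in>\<phi> - {\<mu>, - \<mu>}. {x. aff_val \<nu> (p x) = 0}) \<noteq> UNIV"
    using non_negligible_UNIV by metis
  then obtain x where "\<And>\<nu>. \<nu> \<in> \<phi> - {\<mu>, - \<mu>} \<Longrightarrow> aff_val \<nu> (p x) \<noteq> 0" by blast
  with p0[of x] show thesis by (intro that[of "p x"]) auto
qed

lemma group_generated_by_simple: "W = refl_group \<delta>"
proof
  have "aff_refl \<mu> \<in> refl_group \<delta>" if \<mu>: "\<mu> \<in> \<phi>" for \<mu>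
  proof -
    obtain y where y: "aff_val \<mu> y = 0" "\<And>\<nu>. \<nu> \<in> \<phi> \<Longrightarrow> aff_val \<nu> y = 0 \<Longrightarrow> \<nu> = \<mu> \<or> \<nu> = - \<mu>"
      using generic_point_on_hyperplane[OF \<mu>] by metis
    obtain g where g: "g \<in> refl_group \<delta>" "\<And>\<kappa>. \<kappa> \<in> \<delta> \<Longrightarrow> 0 \<le> aff_val \<kappa> (g y)"
      using move_to_closure by metis
    obtain h where h: "h \<in> refl_group \<delta>" "h \<circ> g = id" "g \<circ> h = id"
      using refl_group_inverse[OF g(1)] .
    have gW: "g \<in> W" and hW: "h \<in> W" using g h simple_subgroup by auto
    note rg = refl_group_rigid[OF gW] and rh = refl_group_rigid[OF hW]
    have hg: "h (g z) = z" for z using h(2) by (metis comp_apply id_apply)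
    \<comment> \<open>No root vanishes on \<open>F\<close>, but the image of \<open>\<mu>\<close>
      under \<open>g\<close> vanishes at \<open>g y\<close>. So some simple root vanishes
      there.\<close>
    have "g y \<notin> F"
    proof
      assume *: "g y \<in> F"
      have "aff_val (root_act g \<mu>) (g y) = 0" using y(1) by (simp add: aff_val_root_act[OF rg])
      then show False
        using pos_or_neg[OF root_act_closed[OF gW \<mu>]] pos_on_region[OF _ *] aff_val_uminus
        by (metis less_irrefl neg_0_equal_iff_equal)
    qed
    then obtain \<kappa> where \<kappa>: "\<kappa> \<in> \<delta>" "aff_val \<kappa> (g y) = 0"
      using g(2) by (force simp: pos_region_def)
    \<comment> \<open>Pulled back by \<open>h\<close>, this simple root vanishes at the generic
      point, so it is \<open>\<mu>\<close> up to sign; both signs give the same reflection.\<close>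
    have "aff_val (root_act h \<kappa>) y = 0"
      using aff_val_root_act[OF rh, of \<kappa> "g y"] \<kappa>(2) by (simp add: hg)
    then have "root_act h \<kappa> = \<mu> \<or> root_act h \<kappa> = - \<mu>"
      using y(2) root_act_closed[OF hW simple_root[OF \<kappa>(1)]] by blast
    then have "aff_refl \<mu> = aff_refl (root_act h \<kappa>)" by auto
    then have "aff_refl \<mu> = h \<circ> aff_refl \<kappa> \<circ> g"
      using aff_refl_root_act[OF rh, of \<kappa> "g _"] by (simp add: fun_eq_iff hg)
    then show ?thesis
      using g(1) h(1) \<kappa>(1) by (simp add: refl_group_comp refl_group_aff_refl del: comp_apply)
  qed
  then show "W \<subseteq> refl_group \<delta>" by (rule refl_group_mono)
qed (rule simple_subgroup)

text \<open>If two translates meet, then \<open>u \<circ> w\<close>, with \<open>u\<close> the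
  inverse of \<open>v\<close>, carries one point of \<open>F\<close> to another. It therefore keeps
  positive roots positive, and only the identity does that.\<close>

lemma disjoint_translates: "disjoint_family_on (\<lambda>w. w ` F) W"
proof (unfold disjoint_family_on_def, intro ballI impI, rule ccontr)
  fix v w assume vw: "v \<in> W" "w \<in> W" "v \<noteq> w" "v ` F \<inter> w ` F \<noteq> {}"
  then obtain x y where xy: "x \<in> F" "y \<in> F" "v x = w y" by auto
  obtain u where u: "u \<in> W" "u \<circ> v = id" "v \<circ> u = id"
    using refl_group_inverse[OF vw(1)] .
  have uw: "u \<circ> w \<in> W" using u vw refl_group_comp by blast
  have "(u \<circ> w) y = x" using u(2) xy(3) by (metis comp_apply id_apply)
  have "root_act (u \<circ> w) \<mu> \<in> P" if "\<mu> \<in> P" for \<mu>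
  proof -
    have "\<mu> \<in> \<phi>" using that pos_subset by auto
    have "aff_val (root_act (u \<circ> w) \<mu>) x = aff_val \<mu> y"
      using aff_val_root_act[OF refl_group_rigid[OF uw], of \<mu> y] \<open>(u \<circ> w) y = x\<close> by simp
    then show ?thesis
      using pos_iff[OF xy(1) root_act_closed[OF uw \<open>\<mu> \<in> \<phi>\<close>]] pos_on_region[OF that xy(2)] by simp
  qed
  moreover obtain ms where "ms \<in> lists \<delta>" "u \<circ> w = word ms"
    using uw unfolding group_generated_by_simple by (auto simp: refl_group_eq_words)
  ultimately have "u \<circ> w = id" using word_fixing_positive by metis
  then have "v = w" using u(3) by (metis comp_assoc comp_id id_comp)
  with vw show False by simp
qed

text \<open>The countably many root hyperplanes form a null set. Off them no simple root vanishes at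
  the point moved into the closure of \<open>F\<close>, so that point lies in
  \<open>F\<close>.\<close>

lemma AE_covered: "AE x in lebesgue. \<exists>w\<in>W. x \<in> w ` F"
proof -
  have "negligible {x. aff_val \<mu> x = 0}" if "\<mu> \<in> \<phi>" for \<mu>
    using negligible_hyperplane[of "fst \<mu>" "snd \<mu>"] nonzero[OF that] by (simp add: aff_val_def)
  then have "AE x in lebesgue. aff_val \<mu> x \<noteq> 0" if "\<mu> \<in> \<phi>" for \<mu>
    using that by (intro AE_I'[of "{x. aff_val \<mu> x = 0}"]) (auto simp: negligible_iff_null_sets)
  then have "AE x in lebesgue. \<forall>\<mu>\<in>\<phi>. aff_val \<mu> x \<noteq> 0"
    using countable by (simp add: AE_ball_countable)
  then show ?thesis
  proof (rule AE_mp, intro AE_I2 impI)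
    fix x assume x: "\<forall>\<mu>\<in>\<phi>. aff_val \<mu> x \<noteq> 0"
    obtain g where g: "g \<in> refl_group \<delta>" "\<And>\<kappa>. \<kappa> \<in> \<delta> \<Longrightarrow> 0 \<le> aff_val \<kappa> (g x)"
      using move_to_closure by metis
    obtain h where h: "h \<in> refl_group \<delta>" "h \<circ> g = id" "g \<circ> h = id"
      using refl_group_inverse[OF g(1)] .
    have hW: "h \<in> W" using h simple_subgroup by auto
    have hg: "h (g z) = z" for z using h(2) by (metis comp_apply id_apply)
    have "aff_val \<kappa> (g x) \<noteq> 0" if "\<kappa> \<in> \<delta>" for \<kappa>
      using aff_val_root_act[OF refl_group_rigid[OF hW], of \<kappa> "g x"]
        root_act_closed[OF hW simple_root[OF that]] x hg by metis
    then have "g x \<in> F" using g(2) by (force simp: pos_region_def)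
    then show "\<exists>w\<in>W. x \<in> w ` F" using hW hg[of x] by (metis imageI)
  qed
qed

end

subsection \<open>Consistent sets of roots\<close>

locale consistent_roots = affine_root_datum +
  fixes I
  assumes I_subset: "I \<subseteq> P"
    and consistent: "consistent W P \<delta> I"
    and disjoint_orbit: "A \<in> pos_orbit W P I \<Longrightarrow> disjoint_family_on (\<lambda>w. w ` pos_region A) (refl_group A)"
begin

abbreviation "\<O> \<equiv> pos_orbit W P I"
abbreviation "orbit_sign \<equiv> eps_set W P I"

lemma finite_orbit: "finite \<O>"
  and eps_stabilizer: "w \<in> W \<Longrightarrow> root_act w ` I = I \<Longrightarrow> eps w = 1"
  using consistent by (auto simp: consistent_def)

lemma orbit_subset: "A \<in> \<O> \<Longrightarrow> A \<subseteq> P"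
  by (auto simp: pos_orbit_def pos_movers_def)

text \<open>Two elements with the same image of \<open>I\<close> differ by an element of the
  stabilizer of \<open>I\<close>, whose sign is 1 by consistency; so the choice inside
  \<open>eps_set\<close> is harmless.\<close>

lemma eps_set_eq:
  assumes "w \<in> pos_movers W P I"
  shows "orbit_sign (root_act w ` I) = eps w"
proof -
  let ?v = "SOME v. v \<in> pos_movers W P I \<and> root_act v ` I = root_act w ` I"
  have v: "?v \<in> pos_movers W P I" "root_act ?v ` I = root_act w ` I"
    using someI_ex[of "\<lambda>v. v \<in> pos_movers W P I \<and> root_act v ` I = root_act w ` I"] assms by auto
  have W: "w \<in> W" "?v \<in> W" using assms v(1) by (auto simp: pos_movers_def)
  obtain u where u: "u \<in> W" "u \<circ> w = id" "w \<circ> u = id"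
    using refl_group_inverse[OF W(1)] .
  have r: "rigid u" "rigid w" using refl_group_rigid u W by auto
  have "root_act (u \<circ> ?v) ` I = root_act (u \<circ> w) ` I"
    using v(2) by (simp add: root_act_comp[OF r(1)] image_image[symmetric] del: comp_apply)
  then have "eps (u \<circ> ?v) = 1"
    using u W by (intro eps_stabilizer refl_group_comp) auto
  moreover have "eps u * eps w = 1" using u(2) eps_comp[OF r(1), of w] by simp
  ultimately have "eps u * eps ?v = eps u * eps w" "eps u \<noteq> 0" by (auto simp: eps_comp[OF r(1)])
  then show ?thesis by (simp add: eps_set_def)
qed

lemma I_orbit: "I \<in> \<O>" "orbit_sign I = 1"
proof -
  have *: "id \<in> pos_movers W P I" using I_subset by (auto simp: pos_movers_def refl_group_id)
  then show "I \<in> \<O>" by (force simp: pos_orbit_def)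
  show "orbit_sign I = 1" using eps_set_eq[OF *] by simp
qed

text \<open>The reflection in \<open>\<kappa>\<close> keeps all positive roots but
  \<open>\<kappa>\<close> positive, so it can be composed with an element moving \<open>I\<close> to
  \<open>A\<close>. The reflected set could contain \<open>\<kappa>\<close> only if \<open>A\<close>
  contained \<open>- \<kappa>\<close>.\<close>

lemma orbit_reflect:
  assumes A: "A \<in> \<O>" and \<kappa>: "\<kappa> \<in> \<delta>" "\<kappa> \<notin> A"
  shows "root_act (aff_refl \<kappa>) ` A \<in> \<O>" "\<kappa> \<notin> root_act (aff_refl \<kappa>) ` A"
    "orbit_sign (root_act (aff_refl \<kappa>) ` A) = - orbit_sign A"
proof -
  let ?s = "aff_refl \<kappa>"
  obtain w where w: "w \<in> pos_movers W P I" "A = root_act w ` I"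
    using A by (auto simp: pos_orbit_def)
  have sA: "root_act (?s \<circ> w) ` I = root_act ?s ` A"
    by (simp add: w(2) root_act_comp[OF rigid_aff_refl] image_image del: comp_apply)
  have "root_act ?s ` A \<subseteq> P"
    using simple_permutes[OF \<kappa>(1)] \<kappa>(2) orbit_subset[OF A] by (intro image_subsetI) blast
  then have sw: "?s \<circ> w \<in> pos_movers W P I"
    using w(1) \<kappa>(1) simple_root
    by (auto simp: pos_movers_def sA refl_group_comp refl_group_aff_refl simp del: comp_apply)
  then show "root_act ?s ` A \<in> \<O>" by (force simp: pos_orbit_def sA[symmetric])
  show "orbit_sign (root_act ?s ` A) = - orbit_sign A"
    using eps_set_eq[OF sw] eps_set_eq[OF w(1)] simple_nonzero[OF \<kappa>(1)]
    by (simp add: sA w(2)[symmetric] eps_comp[OF rigid_aff_refl] eps_aff_refl del: comp_apply)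
  show "\<kappa> \<notin> root_act ?s ` A"
  proof
    assume "\<kappa> \<in> root_act ?s ` A"
    then have "- \<kappa> \<in> A" using root_act_aff_refl_self[OF simple_nonzero[OF \<kappa>(1)]]
      by (metis imageE root_act_aff_refl_invol)
    then show False using orbit_subset[OF A] simple_subset \<kappa>(1) uminus_pos by blast
  qed
qed

text \<open>Reindexing along the sign-reversing involution of the orbit members that avoid
  \<open>\<kappa>\<close>. The weight \<open>q\<close> and the restriction \<open>Q\<close> allow it
  to serve both for the sum of signs and for \<open>total_sign\<close>.\<close>

lemma sum_orbit_reflect:
  assumes \<kappa>: "\<kappa> \<in> \<delta>" and Q: "\<And>A. Q A \<Longrightarrow> Q (root_act (aff_refl \<kappa>) ` A)"
  shows "(\<Sum>A\<in>{A \<in> \<O>. \<kappa> \<notin> A \<and> Q A}. orbit_sign A * q A)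
       = - (\<Sum>A\<in>{A \<in> \<O>. \<kappa> \<notin> A \<and> Q A}. orbit_sign A * q (root_act (aff_refl \<kappa>) ` A))"
  unfolding sum_negf[symmetric]
  by (rule sum.reindex_bij_witness[of _ "\<lambda>A. root_act (aff_refl \<kappa>) ` A" "\<lambda>A. root_act (aff_refl \<kappa>) ` A"])
    (use assms orbit_reflect in \<open>auto simp: image_image\<close>)

lemma sum_eps_orbit: "(\<Sum>A\<in>\<O>. orbit_sign A) = 1"
proof -
  obtain J where J: "J \<subseteq> \<delta>" "J \<subseteq> I" "pairwise orth J" "\<And>A. A \<in> \<O> \<Longrightarrow> J \<subseteq> A \<Longrightarrow> A = I"
    using consistent unfolding consistent_def by auto
  have finite_J: "finite J" using J(1) finite_simple by (rule finite_subset)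
  \<comment> \<open>The elements of \<open>J\<close> are imposed one at a time: requiring one more
    root \<open>\<kappa>\<close> discards only sets avoiding \<open>\<kappa>\<close>, and their
    signs cancel.\<close>
  have "(\<Sum>A\<in>{A \<in> \<O>. K \<subseteq> A}. orbit_sign A) = (\<Sum>A\<in>\<O>. orbit_sign A)" if "finite K" "K \<subseteq> J" for K
    using that
  proof induction
    case (insert \<kappa> K)
    let ?s = "aff_refl \<kappa>"
    have \<kappa>: "\<kappa> \<in> \<delta>" using insert J(1) by blast
    have fix_K: "root_act ?s \<mu> = \<mu>" if "\<mu> \<in> K" for \<mu>
      using J(3) insert that by (intro root_act_aff_refl_orth pairwiseD[of orth J]) auto
    have "K \<subseteq> root_act ?s ` A" if "K \<subseteq> A" for A
    proof
      fix \<mu> assume "\<mu> \<in> K"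
      with that show "\<mu> \<in> root_act ?s ` A"
        using image_eqI[of \<mu> "root_act ?s" \<mu> A] fix_K[of \<mu>] by (simp add: subset_eq)
    qed
    then have "(\<Sum>A\<in>{A \<in> \<O>. \<kappa> \<notin> A \<and> K \<subseteq> A}. orbit_sign A * 1) = - (\<Sum>A\<in>{A \<in> \<O>. \<kappa> \<notin> A \<and> K \<subseteq> A}. orbit_sign A * 1)"
      using sum_orbit_reflect[OF \<kappa>, of "\<lambda>A. K \<subseteq> A" "\<lambda>_. 1"] by blast
    then have "(\<Sum>A\<in>{A \<in> \<O>. \<kappa> \<notin> A \<and> K \<subseteq> A}. orbit_sign A) = 0" by simp
    moreover have "(\<Sum>A\<in>{A \<in> \<O>. K \<subseteq> A}. orbit_sign A)
        = (\<Sum>A\<in>{A \<in> \<O>. insert \<kappa> K \<subseteq> A}. orbit_sign A) + (\<Sum>A\<in>{A \<in> \<O>. \<kappa> \<notin> A \<and> K \<subseteq> A}. orbit_sign A)"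
      using finite_orbit by (subst sum.union_disjoint[symmetric]) (auto intro!: sum.cong)
    ultimately show ?case using insert by simp
  qed simp
  from this[OF finite_J order_refl] have "(\<Sum>A\<in>{A \<in> \<O>. J \<subseteq> A}. orbit_sign A) = (\<Sum>A\<in>\<O>. orbit_sign A)" .
  moreover have "{A \<in> \<O>. J \<subseteq> A} = {I}" using J I_orbit by auto
  ultimately show ?thesis using I_orbit by simp
qed

text \<open>The function \<open>h\<close> of the opening sketch.\<close>

definition total_sign :: "'a \<Rightarrow> real" where
  "total_sign x = (\<Sum>A\<in>\<O>. orbit_sign A * sign_sum A A x)"

lemma total_sign_reflect:
  assumes \<kappa>: "\<kappa> \<in> \<delta>"
  shows "total_sign (aff_refl \<kappa> x) = - total_sign x"
proof -
  note k0 = simple_nonzero[OF \<kappa>]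
  have split: "total_sign y = (\<Sum>A\<in>{A \<in> \<O>. \<kappa> \<in> A}. orbit_sign A * sign_sum A A y)
      + (\<Sum>A\<in>{A \<in> \<O>. \<kappa> \<notin> A}. orbit_sign A * sign_sum A A y)" for y
    unfolding total_sign_def
    using finite_orbit by (subst sum.union_disjoint[symmetric]) (auto intro!: sum.cong)
  \<comment> \<open>After the involution the set and the point are both reflected, so
    \<open>sign_sum\<close> returns to its value for \<open>A\<close> at \<open>x\<close>.\<close>
  have "(\<Sum>A\<in>{A \<in> \<O>. \<kappa> \<notin> A}. orbit_sign A * sign_sum A A (aff_refl \<kappa> x))
      = - (\<Sum>A\<in>{A \<in> \<O>. \<kappa> \<notin> A}. orbit_sign A * sign_sum A A x)"
    using sum_orbit_reflect[OF \<kappa>, of "\<lambda>_. True" "\<lambda>A. sign_sum A A (aff_refl \<kappa> x)"]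
    by (simp add: sign_sum_root_act[OF k0])
  moreover have "(\<Sum>A\<in>{A \<in> \<O>. \<kappa> \<in> A}. orbit_sign A * sign_sum A A (aff_refl \<kappa> x))
      = - (\<Sum>A\<in>{A \<in> \<O>. \<kappa> \<in> A}. orbit_sign A * sign_sum A A x)"
    unfolding sum_negf[symmetric] by (rule sum.cong) (auto simp: sign_sum_reflect[OF _ k0])
  ultimately show ?thesis by (simp add: split)
qed

lemma total_sign_equivariant:
  assumes "w \<in> W"
  shows "total_sign (w x) = eps w * total_sign x"
proof -
  have "total_sign (word ms x) = eps (word ms) * total_sign x" if "ms \<in> lists \<delta>" for ms
    using that
  proof induction
    case (Cons \<kappa> ms)
    have "eps (word (\<kappa> # ms)) = - eps (word ms)"
      unfolding word_Cons eps_comp[OF rigid_aff_refl] eps_aff_refl[OF simple_nonzero[OF Cons.hyps(1)]]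
      by simp
    moreover have "word (\<kappa> # ms) x = aff_refl \<kappa> (word ms x)" by simp
    ultimately show ?case using Cons by (simp only: total_sign_reflect)
  qed (metis eps_id id_apply mult_1 word_Nil)
  then show ?thesis
    using assms unfolding group_generated_by_simple by (auto simp: refl_group_eq_words)
qed

text \<open>Every \<open>A\<close> in the orbit consists of positive roots, so \<open>x\<close> lies
  in its region and the identity is the element that counts; what remains is the sum of the orbit
  signs.\<close>

lemma total_sign_region:
  assumes "x \<in> F"
  shows "total_sign x = 1"
proof -
  have "sign_sum A A x = 1" if "A \<in> \<O>" for A
  proof -
    have "x \<in> id ` pos_region A"
      using assms region_subset orbit_subset[OF that] by (auto simp: pos_region_def)
    then show ?thesis using sign_sum_disjoint[OF disjoint_orbit[OF that] refl_group_id] by simp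
  qed
  then show ?thesis by (simp add: total_sign_def sum_eps_orbit)
qed

lemma AE_sign_sum_eq_total_sign: "AE x in lebesgue. sign_sum \<phi> \<delta> x = total_sign x"
  using AE_covered
proof (rule AE_mp, intro AE_I2 impI)
  fix x assume "\<exists>w\<in>W. x \<in> w ` F"
  then obtain w y where w: "w \<in> W" "x = w y" "y \<in> F" by auto
  have "sign_sum \<phi> \<delta> x = eps w"
    using w by (intro sign_sum_disjoint disjoint_translates) auto
  also have "\<dots> = total_sign x"
    by (simp add: w total_sign_equivariant total_sign_region)
  finally show "sign_sum \<phi> \<delta> x = total_sign x" .
qed

lemma integral_region:
  fixes f :: "'a \<Rightarrow> real"
  assumes f: "integrable lebesgue f"
  shows "(AE y in lebesgue. y \<in> F \<longrightarrow> (\<lambda>w. eps w * f (w y)) summable_on W) \<and>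
         set_integrable lebesgue F (\<lambda>y. \<Sum>\<^sub>\<infinity>w\<in>W. eps w * f (w y)) \<and>
         (\<forall>A \<in> \<O>.
            (\<forall>w \<in> refl_group A. set_integrable lebesgue (pos_region A) (\<lambda>y. f (w y))) \<and>
            (\<lambda>w. eps w * (LINT y:pos_region A|lebesgue. f (w y))) summable_on refl_group A) \<and>
         (LINT y:F|lebesgue. (\<Sum>\<^sub>\<infinity>w\<in>W. eps w * f (w y))) =
           (\<Sum>A \<in> \<O>. orbit_sign A * (\<Sum>\<^sub>\<infinity>w\<in>refl_group A. eps w * (LINT y:pos_region A|lebesgue. f (w y))))"
proof -
  \<comment> \<open>A translate of a region is the region of the transported roots, hence
    measurable.\<close>
  have sets: "g ` pos_region A \<in> sets lebesgue" if A: "countable A" and g: "g \<in> refl_group B"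
    for g :: "'a \<Rightarrow> 'a" and A B
  proof -
    obtain h where h: "h \<in> refl_group B" "h \<circ> g = id" "g \<circ> h = id"
      using refl_group_inverse[OF g] .
    have "g ` pos_region A = pos_region (root_act g ` A)"
      by (rule pos_region_root_act[OF refl_group_rigid[OF g] h(2,3), symmetric])
    then show ?thesis using A by (simp add: sets_pos_region)
  qed
  have cnt: "countable A" if "A \<in> \<O>" for A
    using countable orbit_subset[OF that] pos_subset by (meson countable_subset)
  have "countable \<delta>" using countable simple_root by (meson countable_subset subsetI)
  note T = countable_refl_group[OF countable] refl_group_rigid sets_pos_region[OF \<open>countable \<delta>\<close>]
    sets[OF \<open>countable \<delta>\<close>] disjoint_translates eps_refl_group f
  note TA = countable_refl_group[OF cnt] refl_group_rigid sets_pos_region[OF cnt]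
    sets[OF cnt] disjoint_orbit eps_refl_group f
  have int: "integrable lebesgue (\<lambda>x. f x * sign_sum A A x)" if "A \<in> \<O>" for A
    unfolding sign_sum_def by (rule integrable_mult_sign_translates[OF TA]) (use that in auto)
  have eq: "(\<Sum>\<^sub>\<infinity>w\<in>refl_group A. eps w * (LINT y:pos_region A|lebesgue. f (w y)))
      = (LINT x|lebesgue. f x * sign_sum A A x)" if "A \<in> \<O>" for A
    unfolding sign_sum_def by (rule infsum_integral_translates[OF TA]) (use that in auto)
  have sF: "AE y in lebesgue. y \<in> F \<longrightarrow> (\<lambda>w. eps w * f (w y)) summable_on W"
    by (rule AE_summable_on_translates[OF T]) auto
  have iF: "set_integrable lebesgue F (\<lambda>y. \<Sum>\<^sub>\<infinity>w\<in>W. eps w * f (w y))"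
    by (rule set_integrable_infsum_translates[OF T]) auto
  have iA: "set_integrable lebesgue (pos_region A) (\<lambda>y. f (w y))" if "A \<in> \<O>" "w \<in> refl_group A" for A w
    by (rule set_integrable_translate[OF TA(2) TA(3) TA(4) f]) (use that in auto)
  have sA: "(\<lambda>w. eps w * (LINT y:pos_region A|lebesgue. f (w y))) summable_on refl_group A"
    if "A \<in> \<O>" for A
    by (rule summable_on_integral_translates[OF TA]) (use that in auto)
  have "(LINT y:F|lebesgue. (\<Sum>\<^sub>\<infinity>w\<in>W. eps w * f (w y)))
      = (\<Sum>\<^sub>\<infinity>w\<in>W. eps w * (LINT y:F|lebesgue. f (w y)))"
    by (rule set_integral_infsum_translates[OF T]) auto
  also have "\<dots> = (LINT x|lebesgue. f x * sign_sum \<phi> \<delta> x)"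
    unfolding sign_sum_def by (rule infsum_integral_translates[OF T]) auto
  \<comment> \<open>Here the sign function of \<open>W\<close> is replaced by
    \<open>total_sign\<close>, with which it agrees almost everywhere.\<close>
  also have "\<dots> = (LINT x|lebesgue. (\<Sum>A\<in>\<O>. orbit_sign A * (f x * sign_sum A A x)))"
  proof (rule integral_cong_AE)
    show "(\<lambda>x. f x * sign_sum \<phi> \<delta> x) \<in> borel_measurable lebesgue"
      unfolding sign_sum_def
      by (rule borel_measurable_integrable, rule integrable_mult_sign_translates[OF T]) auto
    show "(\<lambda>x. \<Sum>A\<in>\<O>. orbit_sign A * (f x * sign_sum A A x)) \<in> borel_measurable lebesgue"
      by (intro borel_measurable_integrable Bochner_Integration.integrable_sum integrable_mult_right int)
    show "AE x in lebesgue. f x * sign_sum \<phi> \<delta> x = (\<Sum>A\<in>\<O>. orbit_sign A * (f x * sign_sum A A x))"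
      using AE_sign_sum_eq_total_sign
      by (rule AE_mp) (auto simp: total_sign_def sum_distrib_left mult_ac)
  qed
  also have "\<dots> = (\<Sum>A\<in>\<O>. orbit_sign A * (LINT x|lebesgue. f x * sign_sum A A x))"
    by (simp add: Bochner_Integration.integral_sum int)
  also have "\<dots> = (\<Sum>A \<in> \<O>. orbit_sign A * (\<Sum>\<^sub>\<infinity>w\<in>refl_group A. eps w * (LINT y:pos_region A|lebesgue. f (w y))))"
    by (simp add: eq)
  finally show ?thesis using sF iF iA sA by blast
qed

end

subsection \<open>Crystallographic root systems\<close>

lemma nonneg_combsI:
  "\<beta> = (\<Sum>\<delta>\<in>\<Delta>. c \<delta> *\<^sub>R \<delta>) \<Longrightarrow> (\<And>\<delta>. \<delta> \<in> \<Delta> \<Longrightarrow> 0 \<le> c \<delta>) \<Longrightarrow> \<beta> \<in> nonneg_combs \<Delta>"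
  by (auto simp: nonneg_combs_def)

lemma nonneg_combs_add:
  assumes "\<beta> \<in> nonneg_combs \<Delta>" "\<gamma> \<in> nonneg_combs \<Delta>"
  shows "\<beta> + \<gamma> \<in> nonneg_combs \<Delta>"
proof -
  obtain c d where "\<beta> = (\<Sum>\<delta>\<in>\<Delta>. c \<delta> *\<^sub>R \<delta>)" "\<forall>\<delta>\<in>\<Delta>. 0 \<le> c \<delta>"
    and "\<gamma> = (\<Sum>\<delta>\<in>\<Delta>. d \<delta> *\<^sub>R \<delta>)" "\<forall>\<delta>\<in>\<Delta>. 0 \<le> d \<delta>"
    using assms by (auto simp: nonneg_combs_def)
  then show ?thesis
    by (intro nonneg_combsI[of _ "\<lambda>\<delta>. c \<delta> + d \<delta>"]) (simp_all add: scaleR_add_left sum.distrib)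
qed

lemma nonneg_combs_scale:
  assumes "\<beta> \<in> nonneg_combs \<Delta>" "0 \<le> k"
  shows "k *\<^sub>R \<beta> \<in> nonneg_combs \<Delta>"
proof -
  obtain c where "\<beta> = (\<Sum>\<delta>\<in>\<Delta>. c \<delta> *\<^sub>R \<delta>)" "\<forall>\<delta>\<in>\<Delta>. 0 \<le> c \<delta>"
    using assms by (auto simp: nonneg_combs_def)
  then show ?thesis
    using assms(2) by (intro nonneg_combsI[of _ "\<lambda>\<delta>. k * c \<delta>"]) (simp_all add: scaleR_sum_right)
qed

lemma nonneg_combs_base:
  assumes "finite \<Delta>" "\<delta> \<in> \<Delta>"
  shows "\<delta> \<in> nonneg_combs \<Delta>"
proof -
  have "(\<Sum>\<gamma>\<in>\<Delta>. (if \<gamma> = \<delta> then 1 else 0 :: real) *\<^sub>R \<gamma>) = (\<Sum>\<gamma>\<in>\<Delta>. if \<gamma> = \<delta> then \<gamma> else 0)"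
    by (rule sum.cong) auto
  then show ?thesis
    using assms by (intro nonneg_combsI[of _ "\<lambda>\<gamma>. if \<gamma> = \<delta> then 1 else 0"]) simp_all
qed

lemma nonneg_combs_inner:
  assumes "\<beta> \<in> nonneg_combs \<Delta>" "\<And>\<delta>. \<delta> \<in> \<Delta> \<Longrightarrow> 0 \<le> \<delta> \<bullet> x"
  shows "0 \<le> \<beta> \<bullet> x"
  using assms by (auto simp: nonneg_combs_def inner_sum_left intro!: sum_nonneg)

text \<open>Prescribed values on an independent set extend to a linear functional, and the adjoint
  of the functional at 1 is the vector representing it.\<close>

lemma independent_dual_vector:
  fixes \<Delta> :: "'a::euclidean_space set"
  assumes "independent \<Delta>"
  obtains x where "\<And>\<delta>. \<delta> \<in> \<Delta> \<Longrightarrow> \<delta> \<bullet> x = c \<delta>"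
proof -
  obtain h :: "'a \<Rightarrow> real" where h: "linear h" "\<forall>\<delta>\<in>\<Delta>. h \<delta> = c \<delta>"
    using linear_independent_extend[OF assms] by blast
  have "\<delta> \<bullet> adjoint h 1 = h \<delta>" for \<delta>
    using adjoint_works[OF h(1), of \<delta> 1] by simp
  with h(2) show thesis by (intro that[of "adjoint h 1"]) auto
qed

text \<open>Each simple root spans an extreme ray of the cone. Pairing with a vector that is 0 on
  \<open>\<delta>\<close> and 1 on the other simple roots gives two nonnegative numbers with sum 0,
  so only the coefficient at \<open>\<delta>\<close> survives.\<close>

lemma nonneg_combs_sum_in_span_simple:
  fixes \<Delta> :: "'a::euclidean_space set"
  assumes "independent \<Delta>" "\<delta> \<in> \<Delta>" "\<beta> \<in> nonneg_combs \<Delta>" "\<gamma> \<in> nonneg_combs \<Delta>" "\<beta> + \<gamma> \<in> span {\<delta>}"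
  shows "\<beta> \<in> span {\<delta>}"
proof -
  have fin: "finite \<Delta>" using assms(1) by (rule independent_imp_finite)
  obtain x where x: "\<And>\<eta>. \<eta> \<in> \<Delta> \<Longrightarrow> \<eta> \<bullet> x = (if \<eta> = \<delta> then 0 else 1)"
    using independent_dual_vector[OF assms(1), of "\<lambda>\<eta>. if \<eta> = \<delta> then 0 else 1"] by blast
  obtain k where k: "\<beta> + \<gamma> = k *\<^sub>R \<delta>" using assms(5) by (auto simp: span_singleton)
  have "(\<beta> + \<gamma>) \<bullet> x = 0" using x[OF assms(2)] by (simp add: k)
  moreover have "0 \<le> \<beta> \<bullet> x" "0 \<le> \<gamma> \<bullet> x"
    using nonneg_combs_inner[OF assms(3), of x] nonneg_combs_inner[OF assms(4), of x] x by simp_all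
  ultimately have bx: "\<beta> \<bullet> x = 0" by (simp add: inner_add_left)
  obtain c where c: "\<beta> = (\<Sum>\<eta>\<in>\<Delta>. c \<eta> *\<^sub>R \<eta>)" "\<forall>\<eta>\<in>\<Delta>. 0 \<le> c \<eta>"
    using assms(3) by (auto simp: nonneg_combs_def)
  have "(\<Sum>\<eta>\<in>\<Delta>. c \<eta> * (\<eta> \<bullet> x)) = 0" using bx by (simp add: c(1) inner_sum_left)
  then have cx: "\<forall>\<eta>\<in>\<Delta>. c \<eta> * (\<eta> \<bullet> x) = 0"
    using c(2) x fin by (subst (asm) sum_nonneg_eq_0_iff) auto
  have "c \<eta> = 0" if "\<eta> \<in> \<Delta> - {\<delta>}" for \<eta>
    using cx x[of \<eta>] that by auto
  then have "\<beta> = (\<Sum>\<eta>\<in>{\<delta>}. c \<eta> *\<^sub>R \<eta>)"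
    unfolding c(1) using fin assms(2) by (intro sum.mono_neutral_right) auto
  then show ?thesis by (auto simp: span_singleton)
qed

text \<open>Pairing with a vector that is 1 on all of \<open>\<Delta>\<close> gives the sum of the
  nonnegative coefficients, which has to vanish.\<close>

lemma nonneg_combs_pointed:
  fixes \<Delta> :: "'a::euclidean_space set"
  assumes "independent \<Delta>" "\<beta> \<in> nonneg_combs \<Delta>" "- \<beta> \<in> nonneg_combs \<Delta>"
  shows "\<beta> = 0"
proof -
  have fin: "finite \<Delta>" using assms(1) by (rule independent_imp_finite)
  obtain x where x: "\<And>\<eta>. \<eta> \<in> \<Delta> \<Longrightarrow> \<eta> \<bullet> x = 1"
    using independent_dual_vector[OF assms(1), of "\<lambda>_. 1"] by blast
  have "0 \<le> \<beta> \<bullet> x" "0 \<le> (- \<beta>) \<bullet> x"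
    using nonneg_combs_inner[OF assms(2), of x] nonneg_combs_inner[OF assms(3), of x] x by simp_all
  then have bx: "\<beta> \<bullet> x = 0" by simp
  obtain c where c: "\<beta> = (\<Sum>\<eta>\<in>\<Delta>. c \<eta> *\<^sub>R \<eta>)" "\<forall>\<eta>\<in>\<Delta>. 0 \<le> c \<eta>"
    using assms(2) by (auto simp: nonneg_combs_def)
  have "(\<Sum>\<eta>\<in>\<Delta>. c \<eta>) = 0" using bx x by (simp add: c(1) inner_sum_left)
  then have "\<forall>\<eta>\<in>\<Delta>. c \<eta> = 0"
    using c(2) fin by (subst (asm) sum_nonneg_eq_0_iff) auto
  then show ?thesis by (simp add: c(1))
qed

locale based_root_system =
  fixes \<Phi> \<Delta> :: "'a::euclidean_space set"
  assumes roots: "crystallographic_root_system \<Phi>"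
    and base: "simple_system \<Phi> \<Delta>"
begin

abbreviation "\<Phi>\<^sub>p \<equiv> positive_roots \<Phi> \<Delta>"

lemma finite_roots: "finite \<Phi>"
  and root_nonzero: "\<alpha> \<in> \<Phi> \<Longrightarrow> \<alpha> \<noteq> 0"
  and root_multiple: "\<alpha> \<in> \<Phi> \<Longrightarrow> \<beta> \<in> \<Phi> \<Longrightarrow> \<beta> \<in> span {\<alpha>} \<Longrightarrow> \<beta> = \<alpha> \<or> \<beta> = - \<alpha>"
  and cartan_int: "\<alpha> \<in> \<Phi> \<Longrightarrow> \<beta> \<in> \<Phi> \<Longrightarrow> \<beta> \<bullet> coroot \<alpha> \<in> \<int>"
  and uminus_root: "\<alpha> \<in> \<Phi> \<Longrightarrow> - \<alpha> \<in> \<Phi>"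
  using roots unfolding crystallographic_root_system_def by blast+

lemma coroot_swap: "(\<alpha> \<bullet> \<beta>) *\<^sub>R coroot \<alpha> = (\<beta> \<bullet> coroot \<alpha>) *\<^sub>R \<alpha>"
  by (simp add: coroot_def inner_commute)

lemma reflect_eq: "aff_refl (\<alpha>, 0) \<beta> = \<beta> - (\<beta> \<bullet> coroot \<alpha>) *\<^sub>R \<alpha>"
  by (simp add: aff_refl_def aff_val_def coroot_def inner_commute)

lemma reflect_root: "\<alpha> \<in> \<Phi> \<Longrightarrow> \<beta> \<in> \<Phi> \<Longrightarrow> \<beta> - (\<beta> \<bullet> coroot \<alpha>) *\<^sub>R \<alpha> \<in> \<Phi>"
  using roots unfolding crystallographic_root_system_def reflect_eq[symmetric] by blast

lemma simple_subset_roots: "\<Delta> \<subseteq> \<Phi>"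
  and independent_simple: "independent \<Delta>"
  and nonneg_or_nonpos: "\<alpha> \<in> \<Phi> \<Longrightarrow> \<alpha> \<in> nonneg_combs \<Delta> \<or> - \<alpha> \<in> nonneg_combs \<Delta>"
  using base unfolding simple_system_def by blast+

lemma finite_simple_roots: "finite \<Delta>"
  using finite_roots simple_subset_roots finite_subset by blast

lemma pos_root_iff: "\<alpha> \<in> \<Phi>\<^sub>p \<longleftrightarrow> \<alpha> \<in> \<Phi> \<and> \<alpha> \<in> nonneg_combs \<Delta>"
  by (simp add: positive_roots_def)

lemma pos_root_or_neg: "\<alpha> \<in> \<Phi> \<Longrightarrow> \<alpha> \<in> \<Phi>\<^sub>p \<or> - \<alpha> \<in> \<Phi>\<^sub>p"
  using nonneg_or_nonpos uminus_root by (auto simp: pos_root_iff)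

lemma uminus_pos_root: "\<alpha> \<in> \<Phi>\<^sub>p \<Longrightarrow> - \<alpha> \<notin> \<Phi>\<^sub>p"
  using nonneg_combs_pointed[OF independent_simple, of \<alpha>] root_nonzero by (auto simp: pos_root_iff)

lemma simple_root_pos: "\<delta> \<in> \<Delta> \<Longrightarrow> \<delta> \<in> \<Phi>\<^sub>p"
  using simple_subset_roots nonneg_combs_base[OF finite_simple_roots] by (auto simp: pos_root_iff)

text \<open>If the reflected root were negative, \<open>\<beta>\<close> and its negated reflection
  would be cone elements whose sum is a multiple of \<open>\<delta>\<close>. Then
  \<open>\<beta>\<close> is proportional to \<open>\<delta>\<close>, and no positive root other than
  \<open>\<delta>\<close> is.\<close>

lemma simple_reflection_pos:
  assumes "\<delta> \<in> \<Delta>" "\<beta> \<in> \<Phi>\<^sub>p" "\<beta> \<noteq> \<delta>"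
  shows "\<beta> - (\<beta> \<bullet> coroot \<delta>) *\<^sub>R \<delta> \<in> \<Phi>\<^sub>p"
proof (rule ccontr)
  let ?\<gamma> = "\<beta> - (\<beta> \<bullet> coroot \<delta>) *\<^sub>R \<delta>"
  assume *: "?\<gamma> \<notin> \<Phi>\<^sub>p"
  have \<beta>: "\<beta> \<in> \<Phi>" "\<beta> \<in> nonneg_combs \<Delta>" using assms(2) by (auto simp: pos_root_iff)
  have \<delta>: "\<delta> \<in> \<Phi>" using assms(1) simple_subset_roots by blast
  have "- ?\<gamma> \<in> \<Phi>\<^sub>p" using pos_root_or_neg[OF reflect_root[OF \<delta> \<beta>(1)]] * by blast
  then have "- ?\<gamma> \<in> nonneg_combs \<Delta>" by (simp add: pos_root_iff)
  moreover have "\<beta> + - ?\<gamma> \<in> span {\<delta>}" by (auto simp: span_singleton)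
  ultimately have "\<beta> \<in> span {\<delta>}"
    by (rule nonneg_combs_sum_in_span_simple[OF independent_simple assms(1) \<beta>(2)])
  then have "\<beta> = \<delta> \<or> \<beta> = - \<delta>" using root_multiple \<beta> \<delta> by blast
  then show False using assms uminus_pos_root[OF simple_root_pos[OF assms(1)]] by auto
qed

lemma chamber_point:
  obtains x where "\<And>\<delta>. \<delta> \<in> \<Delta> \<Longrightarrow> 0 < \<delta> \<bullet> x"
  using independent_dual_vector[OF independent_simple, of "\<lambda>_. 1"] by (metis zero_less_one)

lemma pos_root_on_chamber:
  assumes "\<beta> \<in> \<Phi>\<^sub>p" "\<And>\<delta>. \<delta> \<in> \<Delta> \<Longrightarrow> 0 < \<delta> \<bullet> x"
  shows "0 < \<beta> \<bullet> x"
proof -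
  obtain c where c: "\<beta> = (\<Sum>\<eta>\<in>\<Delta>. c \<eta> *\<^sub>R \<eta>)" "\<forall>\<eta>\<in>\<Delta>. 0 \<le> c \<eta>"
    using assms(1) by (auto simp: nonneg_combs_def pos_root_iff)
  obtain \<eta> where \<eta>: "\<eta> \<in> \<Delta>" "c \<eta> \<noteq> 0"
  proof (rule ccontr)
    assume "\<not> thesis"
    with that have "\<beta> = 0" unfolding c(1) by (intro sum.neutral) auto
    then show False using root_nonzero assms(1) by (auto simp: pos_root_iff)
  qed
  have "0 < (\<Sum>\<eta>\<in>\<Delta>. c \<eta> * (\<eta> \<bullet> x))"
    using finite_simple_roots \<eta> c(2) assms(2)
    by (intro sum_pos2[of \<Delta> \<eta>]) (auto simp: less_le)
  then show ?thesis by (simp add: c(1) inner_sum_left)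
qed

section \<open>The finite case\<close>

lemma finite_affine_root_datum: "affine_root_datum (\<Phi> \<times> {0}) (\<Phi>\<^sub>p \<times> {0}) (\<Delta> \<times> {0})"
proof
  show "countable (\<Phi> \<times> {0::real})" using finite_roots by (simp add: countable_finite)
  show "fst \<mu> \<noteq> 0" if "\<mu> \<in> \<Phi> \<times> {0::real}" for \<mu> using that root_nonzero by auto
  show "root_act (aff_refl \<mu>) \<nu> \<in> \<Phi> \<times> {0}" if "\<mu> \<in> \<Phi> \<times> {0}" "\<nu> \<in> \<Phi> \<times> {0}" for \<mu> \<nu>
    using that reflect_root[of "fst \<mu>" "fst \<nu>"] by (auto simp: root_act_aff_refl coroot_swap)
  show "fst \<nu> = fst \<mu> \<or> fst \<nu> = - fst \<mu>"
    if "\<mu> \<in> \<Phi> \<times> {0::real}" "\<nu> \<in> \<Phi> \<times> {0::real}" "fst \<nu> \<in> span {fst \<mu>}" for \<mu> \<nu>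
    using that root_multiple[of "fst \<mu>" "fst \<nu>"] by auto
  show "\<Phi>\<^sub>p \<times> {0} \<subseteq> \<Phi> \<times> {0::real}" by (auto simp: pos_root_iff)
  show "\<mu> \<in> \<Phi>\<^sub>p \<times> {0} \<or> - \<mu> \<in> \<Phi>\<^sub>p \<times> {0}" if "\<mu> \<in> \<Phi> \<times> {0::real}" for \<mu>
    using that pos_root_or_neg[of "fst \<mu>"] by auto
  show "finite (\<Delta> \<times> {0::real})" using finite_simple_roots by simp
  show "\<Delta> \<times> {0} \<subseteq> \<Phi>\<^sub>p \<times> {0::real}" using simple_root_pos by auto
  show "root_act (aff_refl \<kappa>) \<mu> \<in> \<Phi>\<^sub>p \<times> {0}" if *: "\<kappa> \<in> \<Delta> \<times> {0}" "\<mu> \<in> \<Phi>\<^sub>p \<times> {0}" "\<mu> \<noteq> \<kappa>" for \<kappa> \<mu>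
  proof -
    obtain \<delta> \<beta> where "\<delta> \<in> \<Delta>" "\<beta> \<in> \<Phi>\<^sub>p" "\<kappa> = (\<delta>, 0)" "\<mu> = (\<beta>, 0)" "\<beta> \<noteq> \<delta>"
      using * by (cases \<kappa>; cases \<mu>) auto
    then show ?thesis using simple_reflection_pos[of \<delta> \<beta>] by (simp add: root_act_aff_refl coroot_swap)
  qed
  show "pos_region (\<Delta> \<times> {0}) \<noteq> {}"
  proof -
    obtain x where "\<And>\<delta>. \<delta> \<in> \<Delta> \<Longrightarrow> 0 < \<delta> \<bullet> x" using chamber_point by blast
    then have "x \<in> pos_region (\<Delta> \<times> {0})" by (auto simp: pos_region_def aff_val_def)
    then show ?thesis by blast
  qed
  show "pos_region (\<Delta> \<times> {0}) \<subseteq> pos_region (\<Phi>\<^sub>p \<times> {0})"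
    using pos_root_on_chamber by (auto simp: pos_region_def aff_val_def)
  show "finite {\<mu> \<in> \<Phi>\<^sub>p \<times> {0}. aff_val \<mu> x < 0}" for x
    by (rule finite_subset[of _ "\<Phi> \<times> {0}"]) (auto simp: pos_root_iff finite_roots)
qed

section \<open>The affine case: highest root and alcove\<close>

context
  fixes \<theta>
  assumes highest: "highest_root \<Phi> \<Delta> \<theta>"
begin

lemma highest_root_pos: "\<theta> \<in> \<Phi>\<^sub>p"
  and highest_root_diff: "\<beta> \<in> \<Phi>\<^sub>p \<Longrightarrow> \<theta> - \<beta> \<in> nonneg_combs \<Delta>"
  using highest by (auto simp: highest_root_def)

lemma highest_root: "\<theta> \<in> \<Phi>" "\<theta> \<in> nonneg_combs \<Delta>" "\<theta> \<noteq> 0"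
  using highest_root_pos root_nonzero by (auto simp: pos_root_iff)

text \<open>A negative pairing \<open>k\<close> is at most -1 by integrality, so the reflection
  \<open>\<beta> - k \<theta>\<close> would be a positive root exceeding \<open>\<theta>\<close>
  enough to force \<open>- \<beta>\<close> into the cone.\<close>

lemma highest_coroot_nonneg:
  assumes \<beta>: "\<beta> \<in> \<Phi>\<^sub>p"
  shows "0 \<le> \<beta> \<bullet> coroot \<theta>"
proof (rule ccontr)
  let ?k = "\<beta> \<bullet> coroot \<theta>"
  assume neg: "\<not> 0 \<le> ?k"
  have "?k \<in> \<int>" using cartan_int \<beta> highest_root by (simp add: pos_root_iff)
  then have k: "?k \<le> - 1" using neg by (auto elim!: Ints_cases)
  have \<beta>n: "\<beta> \<in> \<Phi>" "\<beta> \<in> nonneg_combs \<Delta>" using \<beta> by (auto simp: pos_root_iff)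
  have "\<beta> - ?k *\<^sub>R \<theta> = \<beta> + (- ?k) *\<^sub>R \<theta>" by simp
  also have "\<dots> \<in> nonneg_combs \<Delta>"
    using neg by (intro nonneg_combs_add \<beta>n nonneg_combs_scale highest_root) auto
  finally have "\<theta> - (\<beta> - ?k *\<^sub>R \<theta>) \<in> nonneg_combs \<Delta>"
    using reflect_root[OF highest_root(1) \<beta>n(1)] by (intro highest_root_diff) (simp add: pos_root_iff)
  then have "- (\<beta> + (- ?k - 1) *\<^sub>R \<theta>) \<in> nonneg_combs \<Delta>" by (simp add: algebra_simps)
  moreover have c: "(- ?k - 1) *\<^sub>R \<theta> \<in> nonneg_combs \<Delta>"
    using k by (intro nonneg_combs_scale highest_root) auto
  ultimately have "- (\<beta> + (- ?k - 1) *\<^sub>R \<theta>) + (- ?k - 1) *\<^sub>R \<theta> \<in> nonneg_combs \<Delta>"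
    by (rule nonneg_combs_add)
  then have "- \<beta> \<in> nonneg_combs \<Delta>" by (simp add: algebra_simps)
  then show False using nonneg_combs_pointed[OF independent_simple \<beta>n(2)] root_nonzero[OF \<beta>n(1)] by simp
qed

text \<open>For a pairing \<open>k\<close> of at least 2, either sign of the reflected root
  contradicts maximality of \<open>\<theta>\<close>: a positive one puts
  \<open>- (k - 1) \<theta>\<close> into the cone, a negative one makes \<open>\<beta>\<close> equal
  to \<open>(k - 1) \<theta>\<close>.\<close>

lemma highest_coroot_le_1:
  assumes \<beta>: "\<beta> \<in> \<Phi>\<^sub>p" "\<beta> \<noteq> \<theta>"
  shows "\<beta> \<bullet> coroot \<theta> \<le> 1"
proof (rule ccontr)
  let ?k = "\<beta> \<bullet> coroot \<theta>" and ?\<gamma> = "\<beta> - (\<beta> \<bullet> coroot \<theta>) *\<^sub>R \<theta>"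
  assume large: "\<not> ?k \<le> 1"
  have "?k \<in> \<int>" using cartan_int \<beta> highest_root by (simp add: pos_root_iff)
  then have k: "2 \<le> ?k" using large by (auto elim!: Ints_cases)
  have \<beta>n: "\<beta> \<in> \<Phi>" using \<beta> by (simp add: pos_root_iff)
  have diff: "\<theta> - \<beta> \<in> nonneg_combs \<Delta>" using highest_root_diff \<beta> by blast
  have "?\<gamma> \<in> \<Phi>\<^sub>p \<or> - ?\<gamma> \<in> \<Phi>\<^sub>p"
    using pos_root_or_neg reflect_root highest_root \<beta>n by blast
  then show False
  proof
    assume "?\<gamma> \<in> \<Phi>\<^sub>p"
    then have "?\<gamma> + (\<theta> - \<beta>) \<in> nonneg_combs \<Delta>"
      using diff by (intro nonneg_combs_add) (simp_all add: pos_root_iff)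
    then have "- ((?k - 1) *\<^sub>R \<theta>) \<in> nonneg_combs \<Delta>" by (simp add: algebra_simps)
    moreover have "(?k - 1) *\<^sub>R \<theta> \<in> nonneg_combs \<Delta>"
      using k by (intro nonneg_combs_scale highest_root) auto
    ultimately have "(?k - 1) *\<^sub>R \<theta> = 0" by (intro nonneg_combs_pointed[OF independent_simple])
    then show False using k highest_root by simp
  next
    assume "- ?\<gamma> \<in> \<Phi>\<^sub>p"
    then have "\<theta> - - ?\<gamma> \<in> nonneg_combs \<Delta>" by (rule highest_root_diff)
    then have 1: "\<beta> - (?k - 1) *\<^sub>R \<theta> \<in> nonneg_combs \<Delta>" by (simp add: algebra_simps)
    have "(\<theta> - \<beta>) + (?k - 2) *\<^sub>R \<theta> \<in> nonneg_combs \<Delta>"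
      using k by (intro nonneg_combs_add diff nonneg_combs_scale highest_root) auto
    also have "(\<theta> - \<beta>) + (?k - 2) *\<^sub>R \<theta> = - (\<beta> - (?k - 1) *\<^sub>R \<theta>)"
      by (simp add: algebra_simps scaleR_2)
    finally have "\<beta> - (?k - 1) *\<^sub>R \<theta> = 0"
      by (rule nonneg_combs_pointed[OF independent_simple 1])
    then have "\<beta> \<in> span {\<theta>}" by (auto simp: span_singleton)
    then have "\<beta> = - \<theta>" using root_multiple highest_root \<beta>n \<beta>(2) by blast
    then show False using \<beta>(1) uminus_pos_root[OF highest_root_pos] by simp
  qed
qed

lemma highest_coroot_self: "\<theta> \<bullet> coroot \<theta> = 2"
  using highest_root(3) by (simp add: coroot_inner)

text \<open>The reflection in the affine simple root \<open>(- \<theta>, - 1)\<close> permutes the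
  other positive affine roots. For positive \<open>\<beta>\<close> the pairing is nonnegative and
  lowers \<open>n\<close>; for negative \<open>\<beta>\<close> it is at least -1, except when
  \<open>\<beta> = - \<theta>\<close>.\<close>

lemma highest_reflection_pos:
  assumes "(\<beta>, n) \<in> affine_positive_roots \<Phi> \<Delta>" "(\<beta>, n) \<noteq> (- \<theta>, - 1)"
  shows "(\<beta> - (\<beta> \<bullet> coroot \<theta>) *\<^sub>R \<theta>, n - \<beta> \<bullet> coroot \<theta>) \<in> affine_positive_roots \<Phi> \<Delta>"
proof -
  let ?k = "\<beta> \<bullet> coroot \<theta>"
  have \<beta>: "\<beta> \<in> \<Phi>" and "n \<in> \<int>" and pos: "n = 0 \<and> \<beta> \<in> \<Phi>\<^sub>p \<or> n \<le> - 1"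
    using assms(1) by (auto simp: affine_positive_roots_def affine_roots_def)
  have "?k \<in> \<int>" using cartan_int \<beta> highest_root by blast
  from \<open>n \<in> \<int>\<close> \<open>?k \<in> \<int>\<close> obtain m j where m: "n = of_int m" and j: "?k = of_int j"
    by (auto elim!: Ints_cases)
  have refl: "\<beta> - ?k *\<^sub>R \<theta> \<in> \<Phi>" using reflect_root highest_root \<beta> by blast
  have goal: "n - ?k \<le> - 1 \<or> n - ?k = 0 \<and> \<beta> - ?k *\<^sub>R \<theta> \<in> \<Phi>\<^sub>p"
  proof (cases "\<beta> \<in> \<Phi>\<^sub>p")
    case True
    then have k: "0 \<le> ?k" by (rule highest_coroot_nonneg)
    show ?thesis
    proof (cases "n = 0 \<and> ?k = 0")
      case False
      then show ?thesis using pos k m j by auto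
    qed (use True in auto)
  next
    case False
    then have \<beta>': "- \<beta> \<in> \<Phi>\<^sub>p" and n: "n \<le> - 1" using pos_root_or_neg \<beta> pos by auto
    show ?thesis
    proof (cases "- \<beta> = \<theta>")
      case True
      then have "\<beta> = - \<theta>" by (metis minus_minus)
      then have "?k = - 2" "\<beta> - ?k *\<^sub>R \<theta> = \<theta>" "n \<noteq> - 1"
        using highest_coroot_self assms(2) by (auto simp: scaleR_2)
      \<comment> \<open>The new second coordinate is \<open>m + 2\<close>: it is 0 for
        \<open>m = - 2\<close>, where the root becomes the positive root \<open>\<theta>\<close>,
        and at most -1 below.\<close>
      moreover have "m = - 2 \<or> m \<le> - 3" using n m \<open>n \<noteq> - 1\<close> by (auto simp: le_less)
      ultimately show ?thesis using m highest_root_pos by auto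
    next
      case False
      have "- 1 \<le> ?k" using highest_coroot_le_1[OF \<beta>' False] by simp
      then have "- 1 \<le> j" "m \<le> - 1" using n m j by linarith+
      then have "m - j \<le> - 1 \<or> m - j = 0 \<and> j = - 1" by presburger
      then consider "n - ?k \<le> - 1" | "n - ?k = 0" "?k = - 1"
        unfolding m j by linarith
      then show ?thesis
      proof cases
        case 2
        \<comment> \<open>At second coordinate 0 positivity rests on the root alone; maximality of
          \<open>\<theta>\<close> over \<open>- \<beta>\<close> supplies it.\<close>
        have "\<beta> - ?k *\<^sub>R \<theta> = \<theta> - (- \<beta>)" using 2 by simp
        then have "\<beta> - ?k *\<^sub>R \<theta> \<in> \<Phi>\<^sub>p"
          using refl highest_root_diff[OF \<beta>'] by (metis pos_root_iff)
        then show ?thesis using 2(1) by blast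
      qed simp
    qed
  qed
  then show ?thesis
    using refl \<open>n \<in> \<int>\<close> \<open>?k \<in> \<int>\<close> by (auto simp: affine_positive_roots_def affine_roots_def)
qed

lemma affine_affine_root_datum:
  "affine_root_datum (affine_roots \<Phi>) (affine_positive_roots \<Phi> \<Delta>) (affine_simple_roots \<Delta> \<theta>)"
proof
  have cZ: "countable (\<int> :: real set)" by (simp add: Ints_def)
  show "countable (affine_roots \<Phi>)"
    using finite_roots cZ by (auto simp: affine_roots_def countable_finite)
  show "fst \<mu> \<noteq> 0" if "\<mu> \<in> affine_roots \<Phi>" for \<mu>
    using that root_nonzero by (auto simp: affine_roots_def)
  show "root_act (aff_refl \<mu>) \<nu> \<in> affine_roots \<Phi>" if "\<mu> \<in> affine_roots \<Phi>" "\<nu> \<in> affine_roots \<Phi>" for \<mu> \<nu>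
    using that reflect_root[of "fst \<mu>" "fst \<nu>"] cartan_int[of "fst \<mu>" "fst \<nu>"]
    by (auto simp: affine_roots_def root_act_aff_refl coroot_swap)
  show "fst \<nu> = fst \<mu> \<or> fst \<nu> = - fst \<mu>"
    if "\<mu> \<in> affine_roots \<Phi>" "\<nu> \<in> affine_roots \<Phi>" "fst \<nu> \<in> span {fst \<mu>}" for \<mu> \<nu>
    using that root_multiple[of "fst \<mu>" "fst \<nu>"] by (auto simp: affine_roots_def)
  show "affine_positive_roots \<Phi> \<Delta> \<subseteq> affine_roots \<Phi>"
    by (auto simp: affine_positive_roots_def)
  show "\<mu> \<in> affine_positive_roots \<Phi> \<Delta> \<or> - \<mu> \<in> affine_positive_roots \<Phi> \<Delta>" if "\<mu> \<in> affine_roots \<Phi>" for \<mu>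
  proof -
    obtain \<alpha> n where \<mu>: "\<mu> = (\<alpha>, n)" by fastforce
    have \<alpha>: "\<alpha> \<in> \<Phi>" "- \<alpha> \<in> \<Phi>" and n: "n \<in> \<int>" "- n \<in> \<int>"
      using that uminus_root by (auto simp: \<mu> affine_roots_def)
    have "n = 0 \<or> n \<le> - 1 \<or> - n \<le> - 1" using n(1) by (auto elim!: Ints_cases)
    then show ?thesis
      using \<alpha> n pos_root_or_neg[OF \<alpha>(1)] by (auto simp: \<mu> affine_positive_roots_def affine_roots_def)
  qed
  show "finite (affine_simple_roots \<Delta> \<theta>)"
    using finite_simple_roots by (simp add: affine_simple_roots_def)
  show "affine_simple_roots \<Delta> \<theta> \<subseteq> affine_positive_roots \<Phi> \<Delta>"
    using simple_root_pos simple_subset_roots highest_root uminus_root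
    by (auto simp: affine_simple_roots_def affine_positive_roots_def affine_roots_def)
  show "root_act (aff_refl \<kappa>) \<mu> \<in> affine_positive_roots \<Phi> \<Delta>"
    if \<kappa>: "\<kappa> \<in> affine_simple_roots \<Delta> \<theta>" and \<mu>: "\<mu> \<in> affine_positive_roots \<Phi> \<Delta>" "\<mu> \<noteq> \<kappa>" for \<kappa> \<mu>
  proof -
    obtain \<beta> n where \<mu>_eq: "\<mu> = (\<beta>, n)" by fastforce
    from \<kappa> consider \<delta> where "\<delta> \<in> \<Delta>" "\<kappa> = (\<delta>, 0)" | "\<kappa> = (- \<theta>, - 1)"
      by (auto simp: affine_simple_roots_def)
    then show ?thesis
    proof cases
      case 1
      then have "root_act (aff_refl \<kappa>) \<mu> = (\<beta> - (\<beta> \<bullet> coroot \<delta>) *\<^sub>R \<delta>, n)"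
        by (simp add: \<mu>_eq root_act_aff_refl coroot_def inner_commute)
      then show ?thesis
        using 1 \<mu> simple_reflection_pos[of \<delta> \<beta>] reflect_root[of \<delta> \<beta>] simple_subset_roots
        by (auto simp: \<mu>_eq affine_positive_roots_def affine_roots_def)
    next
      case 2
      then have "root_act (aff_refl \<kappa>) \<mu> = (\<beta> - (\<beta> \<bullet> coroot \<theta>) *\<^sub>R \<theta>, n - \<beta> \<bullet> coroot \<theta>)"
        by (simp add: \<mu>_eq root_act_aff_refl coroot_def inner_commute)
      then show ?thesis using 2 \<mu> highest_reflection_pos by (simp add: \<mu>_eq)
    qed
  qed
  show "pos_region (affine_simple_roots \<Delta> \<theta>) \<noteq> {}"
  proof -
    obtain x where x: "\<And>\<delta>. \<delta> \<in> \<Delta> \<Longrightarrow> 0 < \<delta> \<bullet> x" using chamber_point by blast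
    then have t: "0 < \<theta> \<bullet> x" by (rule pos_root_on_chamber[OF highest_root_pos])
    \<comment> \<open>The scaling makes \<open>\<theta>\<close> take the value 1/2.\<close>
    have "(1 / (2 * (\<theta> \<bullet> x))) *\<^sub>R x \<in> pos_region (affine_simple_roots \<Delta> \<theta>)"
      using x t by (auto simp: pos_region_def affine_simple_roots_def aff_val_def)
    then show ?thesis by blast
  qed
  show "pos_region (affine_simple_roots \<Delta> \<theta>) \<subseteq> pos_region (affine_positive_roots \<Phi> \<Delta>)"
  proof
    fix x assume "x \<in> pos_region (affine_simple_roots \<Delta> \<theta>)"
    then have x: "\<And>\<delta>. \<delta> \<in> \<Delta> \<Longrightarrow> 0 < \<delta> \<bullet> x" and t: "\<theta> \<bullet> x < 1"
      by (auto simp: pos_region_def affine_simple_roots_def aff_val_def)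
    \<comment> \<open>On the alcove every positive root is bounded by \<open>\<theta>\<close>, so
      every root has value above -1, which suffices when \<open>n\<close> is at most -1.\<close>
    have le: "\<beta> \<bullet> x < 1" if "\<beta> \<in> \<Phi>\<^sub>p" for \<beta>
      using nonneg_combs_inner[OF highest_root_diff[OF that], of x] x t
      by (fastforce simp: inner_diff_left less_imp_le)
    have "0 < \<alpha> \<bullet> x - n" if "(\<alpha>, n) \<in> affine_positive_roots \<Phi> \<Delta>" for \<alpha> n
    proof -
      have "\<alpha> \<in> \<Phi>" and n: "n = 0 \<and> \<alpha> \<in> \<Phi>\<^sub>p \<or> n \<le> - 1"
        using that by (auto simp: affine_positive_roots_def affine_roots_def)
      then show ?thesis
        using pos_root_or_neg[of \<alpha>] pos_root_on_chamber[OF _ x, of \<alpha>] le[of "- \<alpha>"] by fastforce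
    qed
    then show "x \<in> pos_region (affine_positive_roots \<Phi> \<Delta>)"
      by (auto simp: pos_region_def aff_val_def)
  qed
  show "finite {\<mu> \<in> affine_positive_roots \<Phi> \<Delta>. aff_val \<mu> x < 0}" for x
  proof (rule finite_subset)
    show "{\<mu> \<in> affine_positive_roots \<Phi> \<Delta>. aff_val \<mu> x < 0} \<subseteq> (SIGMA \<alpha>:\<Phi>. {n \<in> \<int>. \<alpha> \<bullet> x \<le> n \<and> n \<le> 0})"
      by (auto simp: affine_positive_roots_def affine_roots_def aff_val_def)
    show "finite (SIGMA \<alpha>:\<Phi>. {n \<in> \<int>. \<alpha> \<bullet> x \<le> n \<and> n \<le> 0})"
      using finite_roots finite_int_segment by (intro finite_SigmaI) auto
  qed
qed

end

text \<open>The generating sets differ only by signs of affine roots, and opposite roots define the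
  same reflection.\<close>

lemma affine_weyl_group_eq: "affine_weyl_group \<Phi> \<Delta> = refl_group (affine_roots \<Phi>)"
proof
  show "affine_weyl_group \<Phi> \<Delta> \<subseteq> refl_group (affine_roots \<Phi>)"
    unfolding affine_weyl_group_def
    by (intro refl_group_mono refl_group_aff_refl) (auto simp: affine_roots_def pos_root_iff)
  show "refl_group (affine_roots \<Phi>) \<subseteq> affine_weyl_group \<Phi> \<Delta>"
    unfolding affine_weyl_group_def
  proof (rule refl_group_mono)
    fix \<mu> assume \<mu>: "\<mu> \<in> affine_roots \<Phi>"
    then have "\<mu> \<in> \<Phi>\<^sub>p \<times> \<int> \<or> - \<mu> \<in> \<Phi>\<^sub>p \<times> \<int>"
      using pos_root_or_neg[of "fst \<mu>"] by (auto simp: affine_roots_def)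
    then show "aff_refl \<mu> \<in> refl_group (\<Phi>\<^sub>p \<times> \<int>)"
      using refl_group_aff_refl aff_refl_uminus by metis
  qed
qed

end

text \<open>In the affine case the group is infinite, and both \<open>infsum\<close> and the
  integral default to 0 where they do not converge. The convergence and integrability claims ensure
  that the final identity does not rest on such defaults.\<close>

theorem proposition14:
  fixes \<Phi> \<Delta> F :: "'a::euclidean_space set" and \<theta> :: 'a
    and W :: "('a \<Rightarrow> 'a) set"
    and \<phi> P \<delta> I :: "('a \<times> real) set"
    and f :: "'a \<Rightarrow> real"
  assumes "crystallographic_root_system \<Phi>" and "irreducible_roots \<Phi>"
    and "simple_system \<Phi> \<Delta>" and "highest_root \<Phi> \<Delta> \<theta>"
    and "(W, \<phi>, P, \<delta>, F) =
           (weyl_group \<Phi>, \<Phi> \<times> {0}, positive_roots \<Phi> \<Delta> \<times> {0}, \<Delta> \<times> {0}, fundamental_chamber \<Delta>) \<or>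
         (W, \<phi>, P, \<delta>, F) =
           (affine_weyl_group \<Phi> \<Delta>, affine_roots \<Phi>, affine_positive_roots \<Phi> \<Delta>,
            affine_simple_roots \<Delta> \<theta>, fundamental_alcove \<Delta> \<theta>)"
    and "I \<subseteq> P" and "consistent W P \<delta> I"
    and "\<forall>A \<in> pos_orbit W P I. fundamental_region (pos_region A) (refl_group A)"
    and "integrable lebesgue f"
  shows "(AE y in lebesgue. y \<in> F \<longrightarrow> (\<lambda>w. eps w * f (w y)) summable_on W) \<and>
         set_integrable lebesgue F (\<lambda>y. \<Sum>\<^sub>\<infinity>w\<in>W. eps w * f (w y)) \<and>
         (\<forall>A \<in> pos_orbit W P I.
            (\<forall>w \<in> refl_group A. set_integrable lebesgue (pos_region A) (\<lambda>y. f (w y))) \<and>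
            (\<lambda>w. eps w * (LINT y:pos_region A|lebesgue. f (w y))) summable_on refl_group A) \<and>
         (LINT y:F|lebesgue. (\<Sum>\<^sub>\<infinity>w\<in>W. eps w * f (w y))) =
           (\<Sum>A \<in> pos_orbit W P I. eps_set W P I A *
              (\<Sum>\<^sub>\<infinity>w\<in>refl_group A. eps w * (LINT y:pos_region A|lebesgue. f (w y))))"
proof -
  interpret based_root_system \<Phi> \<Delta> by (rule based_root_system.intro) (fact assms)+
  have "affine_root_datum \<phi> P \<delta> \<and> W = refl_group \<phi> \<and> F = pos_region \<delta>"
    using assms(5)
  proof
    assume "(W, \<phi>, P, \<delta>, F) = (weyl_group \<Phi>, \<Phi> \<times> {0}, positive_roots \<Phi> \<Delta> \<times> {0}, \<Delta> \<times> {0}, fundamental_chamber \<Delta>)"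
    moreover have "fundamental_chamber \<Delta> = pos_region (\<Delta> \<times> {0})"
      by (auto simp: fundamental_chamber_def pos_region_def aff_val_def)
    ultimately show ?thesis
      using finite_affine_root_datum by (simp add: weyl_group_def)
  next
    assume "(W, \<phi>, P, \<delta>, F) = (affine_weyl_group \<Phi> \<Delta>, affine_roots \<Phi>, affine_positive_roots \<Phi> \<Delta>,
      affine_simple_roots \<Delta> \<theta>, fundamental_alcove \<Delta> \<theta>)"
    then show ?thesis
      using affine_affine_root_datum[OF assms(4)] affine_weyl_group_eq by (simp add: fundamental_alcove_def)
  qed
  then have datum: "affine_root_datum \<phi> P \<delta>" and W: "W = refl_group \<phi>" and F: "F = pos_region \<delta>"
    by simp_all
  interpret affine_root_datum \<phi> P \<delta> by (fact datum)
  interpret consistent_roots \<phi> P \<delta> I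
    by unfold_locales (use assms(6-8) in \<open>auto simp: W fundamental_region_def\<close>)
  show ?thesis unfolding W F by (rule integral_region[OF assms(9)])
qed

end
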